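(* Let $\mathcal{G}$ be the game induced by the distributed mechanism described in the context. Then (pure-strategy) Nash equilibria of $\mathcal{G}$ exist. Furthermore, any Nash equilibrium $m^*$ of $\mathcal{G}$ induces the optimal allocation, i.e. $\hat{\boldsymbol{x}}(m^* )=\boldsymbol{x}^*$, where $\boldsymbol{x}^*$ is the optimal solution of $$\max_{\boldsymbol{x}\in\mathcal{X}}\ \sum_{i=1}^Nv^i(\boldsymbol{x}^i)-\sum_{t=1}^Tp_t\sum_{i=1}^Nx^i_t-p_0\max_{1\le t\le T}\sum_{i=1}^Nx^i_t .$$
   Context: Setting. There are $N\ge 2$ users $\mathcal{N}=\{1,\dots,N\}$ and $T\ge 1$ time slots. The prices $p_1,\dots,p_T\in\mathbb{R}$ and the peak price $p_0\ge 0$ are fixed. User $i$'s demand vector is $\boldsymbol{x}^i=(x^i_1,\dots,x^i_T)\in\mathbb{R}^T$, and $\boldsymbol{x}=(\boldsymbol{x}^1,\dots,\boldsymbol{x}^N)\in\mathbb{R}^{NT}$. User $i$'s utility is $v^i(\boldsymbol{x}^i)=\sum_{t=1}^T v^i_t(x^i_t)$, where each $v^i_t:\mathbb{R}\to\mathbb{R}$ is twice differentiable and strictly concave. The feasible set $\mathcal{X}=\{\boldsymbol{x}: A\boldsymbol{x}\le\boldsymbol{b}\}$, with $A\in\mathbb{R}^{L\times NT}$ and $\boldsymbol{b}=(b^1,\dots,b^L)\in\mathbb{R}^L_+$, is a (bounded) polytope and is coordinate convex: if $\boldsymbol{x}\in\mathcal{X}$, then setting any components of $\boldsymbol{x}$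 to $0$ gives a point of $\mathcal{X}$. Row $l$ of $A$ has entries $a^{i,l}_t$; put $\boldsymbol{a}^{i,l}=[a^{i,l}_1,\dots,a^{i,l}_T]$ (row vector), so constraint $l$ is $\sum_i\boldsymbol{a}^{i,l}\boldsymbol{x}^i\le b^l$. Let $\mathcal{L}=\{1,\dots,L\}$ and $\mathcal{L}_i=\{l\in\mathcal{L}:\boldsymbol{a}^{i,l}\ne 0\}$. Radial pricing operator: for $\tilde{\boldsymbol{s}}\in\mathbb{R}^T_+$, $\tilde{\boldsymbol{y}}\in\mathbb{R}^T$, and every $i$, $$\mathcal{RP}^i_t(\tilde{\boldsymbol{s}},\tilde{\boldsymbol{y}})=\begin{cases}\dfrac{\tilde s_t}{\sum_{t'}\tilde s_{t'}}\,p_0,&\tilde{\boldsymbol{s}}\neq\boldsymbol{0},\\[2mm] \dfrac{p_0\,\mathbf{1}\{t\in\arg\max_{t'}\tilde y_{t'}\}}{\#(\arg\max_{t'}\tilde y_{t'})},&\tilde{\boldsymbol{s}}=\boldsymbol{0}.\end{cases}$$ Distributed mechanism. The users are the nodes of an undirected message exchange graph, assumed to be a tree (a spanning tree of a connected graph); $\mathcal{N}(i)$ is the set of neighbors of $i$ (excluding $i$). A function $\phi:\mathcal{N}\to\mathcal{N}$ with $\phi(i)\in\mathcal{N}(i)$ for all $i$ is fixed. User $i$'s message is $$m^i=\big((y^i_t)_t,(q^{i,l})_{l\in\mathcal{L}},(s^i_t)_t,(\beta^{i,j}_t)_{t,\,j:\phi(j)=i},(n^{i,j,l})_{l\in\mathcal{L},\,j\in\mathcal{N}(i)},(\nu^{i,j}_t)_{t,\,j\in\mathcal{N}(i)}\big)$$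 with $q^{i,l},s^i_t\in\mathbb{R}_+$ and all other components in $\mathbb{R}$. The allocation is $\hat x^i_t(m)=y^i_t$. Define $$f^{i,j,l}=\boldsymbol{a}^{j,l}\boldsymbol{y}^j+\sum_{h\in\mathcal{N}(j)\setminus\{i\}}n^{j,h,l},\qquad f^{i,j}_t=y^j_t+\sum_{h\in\mathcal{N}(j)\setminus\{i\}}\nu^{j,h}_t\qquad(j\in\mathcal{N}(i)),$$ $$s^{-i}_t=\tfrac1{|\mathcal{N}(i)|}\sum_{j\in\mathcal{N}(i)}s^j_t,\quad q^{-i,l}=\tfrac1{|\mathcal{N}(i)|}\sum_{j\in\mathcal{N}(i)}q^{j,l},\quad \zeta^{-i}_t=\sum_{j\in\mathcal{N}(i)}f^{i,j}_t+\beta^{\phi(i),i}_t,\quad z^{-i}=\max_t\zeta^{-i}_t .$$ The tax of user $i$ is $$\hat t^i(m)=\sum_{t}\big(p_t+\mathcal{RP}^i_t(\boldsymbol{s}^{-i},\boldsymbol{\zeta}^{-i})\big)\hat x^i_t(m)+\sum_{l\in\mathcal{L}_i}q^{-i,l}\boldsymbol{a}^{i,l}\hat{\boldsymbol{x}}^i(m)$$ $$+\sum_{l\in\mathcal{L}}\Big[\sum_{j\in\mathcal{N}(i)}(n^{i,j,l}-f^{i,j,l})^2+(q^{i,l}-q^{-i,l})^2+q^{i,l}\Big(b^l-\sum_{j\in\mathcal{N}(i)}f^{i,j,l}-\boldsymbol{a}^{i,l}\boldsymbol{\beta}^{\phi(i),i}\Big)\Big]$$ $$+\sum_{t}\Big[\sum_{j:\phi(j)=i}(\beta^{i,j}_t-y^j_t)^2+\sum_{j\in\mathcal{N}(i)}(\nu^{i,j}_t-f^{i,j}_t)^2+(s^i_t-s^{-i}_t)^2+s^i_t(z^{-i}-\zeta^{-i}_t)\Big].$$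 The induced game $\mathcal{G}$ has players $\mathcal{N}$, strategies $m^i$, and payoffs $u^i(m)=v^i(\hat{\boldsymbol{x}}^i(m))-\hat t^i(m)$. Nash equilibrium means pure-strategy Nash equilibrium. *)

theory Defs
  imports "HOL-Analysis.Analysis"
begin

text \<open>
  Users, time slots and constraints are the elements of the finite types \<open>'n\<close>, \<open>'t\<close> and \<open>'l\<close>.
  A demand profile is \<open>x :: real^'t^'n\<close>, with \<open>x $ i $ t\<close> the demand of user \<open>i\<close> in slot \<open>t\<close>;
  the constraint matrix is \<open>A :: real^'t^'n^'l\<close>, with \<open>A $ l $ i\<close> the block of row \<open>l\<close>
  that belongs to user \<open>i\<close>.
\<close>

section \<open>The allocation problem\<close>

definition twice_differentiable :: "(real \<Rightarrow> real) \<Rightarrow> bool" where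
  "twice_differentiable f \<longleftrightarrow>
     (\<forall>z. f differentiable (at z)) \<and> (\<forall>z. deriv f differentiable (at z))"

definition strictly_concave :: "(real \<Rightarrow> real) \<Rightarrow> bool" where
  "strictly_concave f \<longleftrightarrow>
     (\<forall>a b c. a \<noteq> b \<longrightarrow> 0 < c \<longrightarrow> c < 1 \<longrightarrow>
        (1 - c) * f a + c * f b < f ((1 - c) * a + c * b))"

definition feasible_set ::
    "real^'t^'n^'l \<Rightarrow> real^'l \<Rightarrow> (real^'t^'n) set" where
  "feasible_set A b = {x. \<forall>l. (\<Sum>i\<in>UNIV. (A $ l $ i) \<bullet> (x $ i)) \<le> b $ l}"

definition coordinate_convex :: "(real^'t^'n) set \<Rightarrow> bool" where
  "coordinate_convex X \<longleftrightarrow>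
     (\<forall>x\<in>X. \<forall>Z. (\<chi> i t. if (i, t) \<in> Z then 0 else x $ i $ t) \<in> X)"

definition utility :: "('n \<Rightarrow> 't \<Rightarrow> real \<Rightarrow> real) \<Rightarrow> 'n \<Rightarrow> real^'t \<Rightarrow> real" where
  "utility v i xi = (\<Sum>t\<in>UNIV. v i t (xi $ t))"

definition welfare ::
    "('n::finite \<Rightarrow> 't::finite \<Rightarrow> real \<Rightarrow> real) \<Rightarrow> real^'t \<Rightarrow> real \<Rightarrow> real^'t^'n \<Rightarrow> real" where
  "welfare v p p0 x =
     (\<Sum>i\<in>UNIV. utility v i (x $ i))
     - (\<Sum>t\<in>UNIV. p $ t * (\<Sum>i\<in>UNIV. x $ i $ t))
     - p0 * Max (range (\<lambda>t. \<Sum>i\<in>UNIV. x $ i $ t))"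

definition optimal_allocation ::
    "('n::finite \<Rightarrow> 't::finite \<Rightarrow> real \<Rightarrow> real) \<Rightarrow> real^'t \<Rightarrow> real \<Rightarrow>
     real^'t^'n^'l \<Rightarrow> real^'l \<Rightarrow> real^'t^'n \<Rightarrow> bool" where
  "optimal_allocation v p p0 A b x \<longleftrightarrow>
     is_arg_max (welfare v p p0) (\<lambda>x. x \<in> feasible_set A b) x"

section \<open>The message exchange graph\<close>

definition nbrs :: "('n \<Rightarrow> 'n \<Rightarrow> bool) \<Rightarrow> 'n \<Rightarrow> 'n set" where
  "nbrs E i = {j. E i j}"

definition simple_cycle :: "('n \<Rightarrow> 'n \<Rightarrow> bool) \<Rightarrow> 'n list \<Rightarrow> bool" where
  "simple_cycle E c \<longleftrightarrow>
     3 \<le> length c \<and> distinct c \<and> successively E c \<and> E (last c) (hd c)"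

definition tree_graph :: "('n \<Rightarrow> 'n \<Rightarrow> bool) \<Rightarrow> bool" where
  "tree_graph E \<longleftrightarrow>
     symp E \<and> irreflp E \<and> (\<forall>i j. E\<^sup>*\<^sup>* i j) \<and> \<not> (\<exists>c. simple_cycle E c)"

section \<open>Messages\<close>

text \<open>
  The fields are, in order, the components \<open>y, q, s, \<beta>, n, \<nu>\<close> of a message.
  The last three are indexed only by certain other users; they are made total by
  requiring the value \<open>undefined\<close> outside their index set, see \<open>messages\<close>.
\<close>

record ('n, 't::finite, 'l::finite) message =
  msg_y :: "real^'t"
  msg_q :: "real^'l"
  msg_s :: "real^'t"
  msg_beta :: "'n \<Rightarrow> real^'t"
  msg_n :: "'n \<Rightarrow> real^'l"
  msg_nu :: "'n \<Rightarrow> real^'t"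

definition messages ::
    "('n \<Rightarrow> 'n \<Rightarrow> bool) \<Rightarrow> ('n \<Rightarrow> 'n) \<Rightarrow> 'n \<Rightarrow> ('n, 't::finite, 'l::finite) message set" where
  "messages E \<phi> i =
     {mi. (\<forall>l. 0 \<le> msg_q mi $ l) \<and> (\<forall>t. 0 \<le> msg_s mi $ t) \<and>
          msg_beta mi \<in> extensional {j. \<phi> j = i} \<and>
          msg_n mi \<in> extensional (nbrs E i) \<and>
          msg_nu mi \<in> extensional (nbrs E i)}"

section \<open>The mechanism\<close>

definition radial_pricing :: "real \<Rightarrow> real^'t \<Rightarrow> real^'t \<Rightarrow> real^'t" where
  "radial_pricing p0 s y =
     (let M = {t. is_arg_max (($) y) (\<lambda>_. True) t} in
      \<chi> t. if s \<noteq> 0 then s $ t / (\<Sum>t'\<in>UNIV. s $ t') * p0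
            else p0 * indicator M t / real (card M))"

definition allocation ::
    "('n \<Rightarrow> ('n, 't::finite, 'l::finite) message) \<Rightarrow> real^'t^'n" where
  "allocation m = (\<chi> i. msg_y (m i))"

text \<open>\<open>f_con E A m i j $ l\<close> and \<open>f_dem E m i j $ t\<close> are \<open>f\<^sup>i\<^sup>,\<^sup>j\<^sup>,\<^sup>l\<close> and \<open>f\<^sup>i\<^sup>,\<^sup>j\<^sub>t\<close>.\<close>

definition f_con ::
    "('n::finite \<Rightarrow> 'n \<Rightarrow> bool) \<Rightarrow> real^'t^'n^'l \<Rightarrow>
     ('n \<Rightarrow> ('n, 't::finite, 'l::finite) message) \<Rightarrow> 'n \<Rightarrow> 'n \<Rightarrow> real^'l" where
  "f_con E A m i j =
     (\<chi> l. (A $ l $ j) \<bullet> msg_y (m j) + (\<Sum>h\<in>nbrs E j - {i}. msg_n (m j) h $ l))"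

definition f_dem ::
    "('n::finite \<Rightarrow> 'n \<Rightarrow> bool) \<Rightarrow>
     ('n \<Rightarrow> ('n, 't::finite, 'l::finite) message) \<Rightarrow> 'n \<Rightarrow> 'n \<Rightarrow> real^'t" where
  "f_dem E m i j =
     (\<chi> t. msg_y (m j) $ t + (\<Sum>h\<in>nbrs E j - {i}. msg_nu (m j) h $ t))"

definition s_avg ::
    "('n::finite \<Rightarrow> 'n \<Rightarrow> bool) \<Rightarrow>
     ('n \<Rightarrow> ('n, 't::finite, 'l::finite) message) \<Rightarrow> 'n \<Rightarrow> real^'t" where
  "s_avg E m i = (\<chi> t. 1 / real (card (nbrs E i)) * (\<Sum>j\<in>nbrs E i. msg_s (m j) $ t))"

definition q_avg ::
    "('n::finite \<Rightarrow> 'n \<Rightarrow> bool) \<Rightarrow>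
     ('n \<Rightarrow> ('n, 't::finite, 'l::finite) message) \<Rightarrow> 'n \<Rightarrow> real^'l" where
  "q_avg E m i = (\<chi> l. 1 / real (card (nbrs E i)) * (\<Sum>j\<in>nbrs E i. msg_q (m j) $ l))"

definition zeta ::
    "('n::finite \<Rightarrow> 'n \<Rightarrow> bool) \<Rightarrow> ('n \<Rightarrow> 'n) \<Rightarrow>
     ('n \<Rightarrow> ('n, 't::finite, 'l::finite) message) \<Rightarrow> 'n \<Rightarrow> real^'t" where
  "zeta E \<phi> m i =
     (\<chi> t. (\<Sum>j\<in>nbrs E i. f_dem E m i j $ t) + msg_beta (m (\<phi> i)) i $ t)"

definition zeta_max ::
    "('n::finite \<Rightarrow> 'n \<Rightarrow> bool) \<Rightarrow> ('n \<Rightarrow> 'n) \<Rightarrow>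
     ('n \<Rightarrow> ('n, 't::finite, 'l::finite) message) \<Rightarrow> 'n \<Rightarrow> real" where
  "zeta_max E \<phi> m i = Max (range (\<lambda>t. zeta E \<phi> m i $ t))"

definition tax ::
    "real^'t \<Rightarrow> real \<Rightarrow> real^'t^'n^'l \<Rightarrow> real^'l \<Rightarrow>
     ('n::finite \<Rightarrow> 'n \<Rightarrow> bool) \<Rightarrow> ('n \<Rightarrow> 'n) \<Rightarrow> 'n \<Rightarrow>
     ('n \<Rightarrow> ('n, 't::finite, 'l::finite) message) \<Rightarrow> real" where
  "tax p p0 A b E \<phi> i m =
     (\<Sum>t\<in>UNIV. (p $ t + radial_pricing p0 (s_avg E m i) (zeta E \<phi> m i) $ t)
                 * allocation m $ i $ t)
   + (\<Sum>l\<in>{l. A $ l $ i \<noteq> 0}. q_avg E m i $ l * ((A $ l $ i) \<bullet> (allocation m $ i)))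
   + (\<Sum>l\<in>UNIV.
        (\<Sum>j\<in>nbrs E i. (msg_n (m i) j $ l - f_con E A m i j $ l)\<^sup>2)
      + (msg_q (m i) $ l - q_avg E m i $ l)\<^sup>2
      + msg_q (m i) $ l * (b $ l - (\<Sum>j\<in>nbrs E i. f_con E A m i j $ l)
                                 - (A $ l $ i) \<bullet> msg_beta (m (\<phi> i)) i))
   + (\<Sum>t\<in>UNIV.
        (\<Sum>j\<in>{j. \<phi> j = i}. (msg_beta (m i) j $ t - msg_y (m j) $ t)\<^sup>2)
      + (\<Sum>j\<in>nbrs E i. (msg_nu (m i) j $ t - f_dem E m i j $ t)\<^sup>2)
      + (msg_s (m i) $ t - s_avg E m i $ t)\<^sup>2
      + msg_s (m i) $ t * (zeta_max E \<phi> m i - zeta E \<phi> m i $ t))"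

definition payoff ::
    "('n::finite \<Rightarrow> 't::finite \<Rightarrow> real \<Rightarrow> real) \<Rightarrow> real^'t \<Rightarrow> real \<Rightarrow>
     real^'t^'n^'l \<Rightarrow> real^'l \<Rightarrow> ('n \<Rightarrow> 'n \<Rightarrow> bool) \<Rightarrow> ('n \<Rightarrow> 'n) \<Rightarrow> 'n \<Rightarrow>
     ('n \<Rightarrow> ('n, 't, 'l::finite) message) \<Rightarrow> real" where
  "payoff v p p0 A b E \<phi> i m = utility v i (allocation m $ i) - tax p p0 A b E \<phi> i m"

section \<open>Pure-strategy Nash equilibrium\<close>

definition nash_equilibrium ::
    "('n \<Rightarrow> 's set) \<Rightarrow> ('n \<Rightarrow> ('n \<Rightarrow> 's) \<Rightarrow> real) \<Rightarrow> ('n \<Rightarrow> 's) \<Rightarrow> bool" where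
  "nash_equilibrium S u m \<longleftrightarrow>
     (\<forall>i. m i \<in> S i) \<and> (\<forall>i. \<forall>d\<in>S i. u i (m(i := d)) \<le> u i m)"

definition mechanism_equilibrium ::
    "('n::finite \<Rightarrow> 't::finite \<Rightarrow> real \<Rightarrow> real) \<Rightarrow> real^'t \<Rightarrow> real \<Rightarrow>
     real^'t^'n^'l \<Rightarrow> real^'l \<Rightarrow> ('n \<Rightarrow> 'n \<Rightarrow> bool) \<Rightarrow> ('n \<Rightarrow> 'n) \<Rightarrow>
     ('n \<Rightarrow> ('n, 't, 'l::finite) message) \<Rightarrow> bool" where
  "mechanism_equilibrium v p p0 A b E \<phi> m \<longleftrightarrow>
     nash_equilibrium (messages E \<phi>) (payoff v p p0 A b E \<phi>) m"

end

theory Submission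
  imports Defs
begin

text \<open>
  A user's payoff separates into one term per message component. The quadratic terms force
  \<open>n\<close>, \<open>\<nu>\<close>, \<open>\<beta>\<close> to copy their targets, and on a tree this makes every user see the true constraint
  and demand totals. The best response in \<open>q\<close> is then \<open>q\<^sup>i\<^sup>,\<^sup>l = max 0 (q\<^sup>-\<^sup>i\<^sup>,\<^sup>l - c\<^sup>l / 2)\<close> with the same slack \<open>c\<^sup>l\<close> for all
  users. Looking at the users with extremal \<open>q\<close> gives \<open>c\<^sup>l \<ge> 0\<close>, consensus, and complementary slackness;
  likewise for \<open>s\<close>, so that the radial price is a subgradient of \<open>p\<^sub>0\<close> times the peak load.
  Each user therefore maximises the Lagrangian of the welfare problem at valid multipliers, which
  is sufficient for optimality. Conversely, multipliers exist at the optimum by Farkas' lemma, without a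
  constraint qualification because all constraints are linear, and announcing them is an equilibrium.
\<close>

section \<open>Convex optimization\<close>

text \<open>A finitely generated convex cone is closed, so a \<open>g\<close> outside it could be
  strictly separated from it. The negated normal of the separating hyperplane would then satisfy the
  premise of \<open>imp\<close> but violate its conclusion.\<close>

lemma farkas:
  fixes w :: "'k \<Rightarrow> 'a::euclidean_space"
  assumes "finite I"
    and imp: "\<And>d. (\<And>k. k \<in> I \<Longrightarrow> w k \<bullet> d \<le> 0) \<Longrightarrow> g \<bullet> d \<le> 0"
  obtains c where "\<And>k. 0 \<le> c k" "g = (\<Sum>k\<in>I. c k *\<^sub>R w k)"
proof -
  define C where "C = {x. \<exists>c. (\<forall>k. 0 \<le> c k) \<and> x = (\<Sum>k\<in>I. c k *\<^sub>R w k)}"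
  have "convex_cone C"
    unfolding convex_cone_iff
  proof (intro conjI ballI allI impI)
    show "0 \<in> C"
      unfolding C_def by (auto intro!: exI[of _ "\<lambda>_. 0"])
  next
    fix x y assume "x \<in> C" "y \<in> C"
    then obtain c c' where "\<forall>k. 0 \<le> c k" "x = (\<Sum>k\<in>I. c k *\<^sub>R w k)"
      "\<forall>k. 0 \<le> c' k" "y = (\<Sum>k\<in>I. c' k *\<^sub>R w k)"
      unfolding C_def by blast
    then show "x + y \<in> C"
      unfolding C_def
      by (auto simp: sum.distrib scaleR_left_distrib intro!: exI[of _ "\<lambda>k. c k + c' k"])
  next
    fix x and r :: real assume "x \<in> C" "0 \<le> r"
    then obtain c where "\<forall>k. 0 \<le> c k" "x = (\<Sum>k\<in>I. c k *\<^sub>R w k)"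
      unfolding C_def by blast
    with \<open>0 \<le> r\<close> show "r *\<^sub>R x \<in> C"
      unfolding C_def by (auto simp: scaleR_sum_right intro!: exI[of _ "\<lambda>k. r * c k"])
  qed
  moreover have "w ` I \<subseteq> C"
  proof
    fix x assume "x \<in> w ` I"
    then obtain k where "k \<in> I" "x = w k" by blast
    moreover have "w k = (\<Sum>k'\<in>I. (if k' = k then 1 else 0) *\<^sub>R w k')"
      using \<open>k \<in> I\<close> \<open>finite I\<close> by (simp add: if_distrib[of "\<lambda>r. r *\<^sub>R _"] cong: if_cong)
    ultimately show "x \<in> C"
      unfolding C_def by (auto intro!: exI[of _ "\<lambda>k'. if k' = k then 1 else 0"])
  qed
  ultimately have hull: "convex_cone hull (w ` I) \<subseteq> C"
    by (simp add: hull_minimal)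
  have "g \<in> convex_cone hull (w ` I)"
  proof (rule ccontr)
    let ?K = "convex_cone hull (w ` I)"
    assume "g \<notin> ?K"
    then obtain a \<beta> where a: "a \<bullet> g < \<beta>" "\<And>x. x \<in> ?K \<Longrightarrow> \<beta> < a \<bullet> x"
      using separating_hyperplane_closed_point[OF convex_convex_cone_hull
        closed_convex_cone_hull[of "w ` I"]] \<open>finite I\<close> by blast
    have neg: "\<beta> < 0"
      using a(2)[OF convex_cone_hull_contains_0] by simp
    have "w k \<bullet> (- a) \<le> 0" if "k \<in> I" for k
    proof (rule ccontr)
      assume "\<not> ?thesis"
      then have pos: "a \<bullet> w k < 0" by (simp add: inner_commute)
      \<comment> \<open>The scaling puts this point of the cone exactly on the hyperplane at level
        \<open>\<beta>\<close>, which strict separation forbids.\<close>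
      have "(\<beta> / (a \<bullet> w k)) *\<^sub>R w k \<in> ?K"
        using pos neg that by (intro convex_cone_hull_mul) (auto simp: hull_inc divide_nonpos_neg)
      from a(2)[OF this] pos show False by simp
    qed
    then have "g \<bullet> (- a) \<le> 0" by (rule imp)
    with a(1) neg show False by (simp add: inner_commute)
  qed
  with hull have "g \<in> C" by blast
  then show ?thesis
    unfolding C_def using that by blast
qed

text \<open>This is what makes the first-order conditions sufficient for global optimality.\<close>

lemma strictly_concave_tangent:
  assumes f: "strictly_concave f" and d: "f differentiable (at x)"
  shows "f y \<le> f x + deriv f x * (y - x)"
proof -
  have "convex_on UNIV (\<lambda>z. - f z)"
  proof (intro convex_onI)
    fix t a c :: real
    assume "0 < t" "t < 1"
    then show "- f ((1 - t) *\<^sub>R a + t *\<^sub>R c) \<le> (1 - t) * - f a + t * - f c"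
      using f[unfolded strictly_concave_def, rule_format, of a c t]
      by (cases "a = c") (auto simp: algebra_simps)
  qed simp
  moreover have "((\<lambda>z. - f z) has_real_derivative - deriv f x) (at x)"
    using d by (auto intro!: DERIV_minus simp: DERIV_deriv_iff_real_differentiable)
  ultimately have "- f y - - f x \<ge> - deriv f x * (y - x)"
    by (intro convex_on_imp_above_tangent[where A = UNIV]) (auto simp: has_field_derivative_at_within)
  then show ?thesis by simp
qed

lemma welfare_eq_load:
  "welfare v p p0 x = (\<Sum>i\<in>UNIV. \<Sum>t\<in>UNIV. v i t (x $ i $ t) - p $ t * x $ i $ t)
     - p0 * Max (range (\<lambda>t. \<Sum>i\<in>UNIV. x $ i $ t))"
proof -
  have "(\<Sum>t\<in>UNIV. p $ t * (\<Sum>i\<in>UNIV. x $ i $ t)) = (\<Sum>i\<in>UNIV. \<Sum>t\<in>UNIV. p $ t * x $ i $ t)"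
    by (subst sum.swap) (simp add: sum_distrib_left)
  then show ?thesis
    unfolding welfare_def utility_def by (simp add: sum_subtractf)
qed

text \<open>The peak \<open>Max\<close> is linearised by an extra coordinate that bounds all slot loads from above,
  so that first-order optimality becomes a system of linear inequalities.\<close>

lemma optimal_allocation_multipliers:
  fixes v :: "'n::finite \<Rightarrow> 't::finite \<Rightarrow> real \<Rightarrow> real"
    and A :: "real^'t^'n^'l::finite"
  assumes "p0 \<ge> 0"
    and diff: "\<And>i t z. v i t differentiable (at z)"
    and opt: "optimal_allocation v p p0 A b x"
  defines "peak \<equiv> Max (range (\<lambda>t. \<Sum>i\<in>UNIV. x $ i $ t))"
  obtains q :: "real^'l" and \<pi> :: "real^'t" where
    "\<And>l. 0 \<le> q $ l" "\<And>t. 0 \<le> \<pi> $ t" "(\<Sum>t\<in>UNIV. \<pi> $ t) = p0"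
    "\<And>l. q $ l \<noteq> 0 \<Longrightarrow> (\<Sum>i\<in>UNIV. A $ l $ i \<bullet> x $ i) = b $ l"
    "\<And>t. \<pi> $ t \<noteq> 0 \<Longrightarrow> (\<Sum>i\<in>UNIV. x $ i $ t) = peak"
    "\<And>i t. deriv (v i t) (x $ i $ t) = p $ t + \<pi> $ t + (\<Sum>l\<in>UNIV. q $ l * A $ l $ i $ t)"
proof -
  define L where "L = {l. (\<Sum>i\<in>UNIV. A $ l $ i \<bullet> x $ i) = b $ l}"
  define P where "P = {t. (\<Sum>i\<in>UNIV. x $ i $ t) = peak}"
  \<comment> \<open>These are the gradients of the active constraints in the variables (demand, peak
    bound): binding rows of \<open>A\<close>, and slots whose load attains the bound. The vector
    \<open>g\<close> below is the gradient of the objective, with the peak bound charged at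
    \<open>p0\<close>.\<close>
  define w :: "'l + 't \<Rightarrow> (real^'t^'n) \<times> real" where
    "w = case_sum (\<lambda>l. (A $ l, 0)) (\<lambda>t. (\<chi> i t'. if t' = t then 1 else 0, -1))"
  define g :: "(real^'t^'n) \<times> real" where
    "g = (\<chi> i t. deriv (v i t) (x $ i $ t) - p $ t, - p0)"
  have feas: "(\<Sum>i\<in>UNIV. A $ l $ i \<bullet> x $ i) \<le> b $ l" for l
    using opt by (auto simp: optimal_allocation_def is_arg_max_def feasible_set_def)
  have le_peak: "(\<Sum>i\<in>UNIV. x $ i $ t) \<le> peak" for t
    unfolding peak_def by simp
  \<comment> \<open>The premise of Farkas' lemma: no direction that keeps the active constraints
    satisfied can improve the objective to first order.\<close>
  have "g \<bullet> D \<le> 0" if D: "\<And>k. k \<in> L <+> P \<Longrightarrow> w k \<bullet> D \<le> 0" for D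
  proof -
    obtain d e where De: "D = (d, e)" by fastforce
    have dL: "(\<Sum>i\<in>UNIV. A $ l $ i \<bullet> d $ i) \<le> 0" if "l \<in> L" for l
      using D[of "Inl l"] that by (auto simp: w_def De inner_vec_def)
    have dP: "(\<Sum>i\<in>UNIV. d $ i $ t) \<le> e" if "t \<in> P" for t
    proof -
      have "(\<chi> i t'. if t' = t then 1 else 0) \<bullet> d = (\<Sum>i\<in>UNIV. d $ i $ t)"
        by (simp add: inner_vec_def if_distrib[of "\<lambda>r. r * _"] cong: if_cong)
      then show ?thesis
        using D[of "Inr t"] that by (auto simp: w_def De)
    qed
    \<comment> \<open>Along the ray, the peak is replaced by the linear bound
      \<open>peak + r * e\<close>. This makes \<open>h\<close> differentiable; it agrees with the
      welfare at 0 and is a lower bound for it whenever the slot loads respect the bound.\<close>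
    define h where "h r = (\<Sum>i\<in>UNIV. \<Sum>t\<in>UNIV. v i t (x $ i $ t + r * d $ i $ t)
        - p $ t * (x $ i $ t + r * d $ i $ t)) - p0 * (peak + r * e)" for r
    have "((\<lambda>r. v i t (x $ i $ t + r * d $ i $ t)) has_real_derivative
        deriv (v i t) (x $ i $ t) * d $ i $ t) (at 0)" for i t
    proof -
      have "(v i t has_real_derivative deriv (v i t) (x $ i $ t)) (at (x $ i $ t + 0 * d $ i $ t))"
        using diff[of i t] DERIV_deriv_iff_real_differentiable by simp
      then show ?thesis
        by (rule DERIV_chain2) (auto intro!: derivative_eq_intros)
    qed
    then have "(h has_real_derivative (\<Sum>i\<in>UNIV. \<Sum>t\<in>UNIV. deriv (v i t) (x $ i $ t) * d $ i $ t
        - p $ t * d $ i $ t) - p0 * e) (at 0)"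
      unfolding h_def by (auto intro!: derivative_eq_intros simp: mult.commute)
    moreover have "(\<Sum>i\<in>UNIV. \<Sum>t\<in>UNIV. deriv (v i t) (x $ i $ t) * d $ i $ t
        - p $ t * d $ i $ t) - p0 * e = g \<bullet> D"
      by (simp add: g_def De inner_vec_def algebra_simps)
    ultimately have h': "(h has_real_derivative g \<bullet> D) (at 0)" by simp
    \<comment> \<open>A binding row stays satisfied because \<open>d\<close> does not increase it, a
      slack row by continuity. The slot loads in \<open>evP\<close> are treated the same
      way.\<close>
    have evL: "\<forall>\<^sub>F r in at_right 0. (\<Sum>i\<in>UNIV. A $ l $ i \<bullet> (x $ i + r *\<^sub>R d $ i)) \<le> b $ l" for l
    proof (cases "l \<in> L")
      case True
      show ?thesis
        unfolding eventually_at_right_field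
      proof (intro exI[of _ 1] conjI allI impI)
        fix r :: real assume "0 < r"
        then show "(\<Sum>i\<in>UNIV. A $ l $ i \<bullet> (x $ i + r *\<^sub>R d $ i)) \<le> b $ l"
          using True dL[OF True] mult_nonneg_nonpos[of r "\<Sum>i\<in>UNIV. A $ l $ i \<bullet> d $ i"]
          by (simp add: L_def inner_add_right sum.distrib sum_distrib_left[symmetric])
      qed simp
    next
      case False
      have "((\<lambda>r. \<Sum>i\<in>UNIV. A $ l $ i \<bullet> (x $ i + r *\<^sub>R d $ i)) \<longlongrightarrow>
          (\<Sum>i\<in>UNIV. A $ l $ i \<bullet> (x $ i + 0 *\<^sub>R d $ i))) (at_right 0)"
        by (intro tendsto_intros)
      then have "\<forall>\<^sub>F r in at_right 0. (\<Sum>i\<in>UNIV. A $ l $ i \<bullet> (x $ i + r *\<^sub>R d $ i)) < b $ l"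
        by (rule order_tendstoD) (use False feas[of l] in \<open>simp add: L_def\<close>)
      then show ?thesis by eventually_elim simp
    qed
    have evP: "\<forall>\<^sub>F r in at_right 0. (\<Sum>i\<in>UNIV. x $ i $ t + r * d $ i $ t) \<le> peak + r * e" for t
    proof (cases "t \<in> P")
      case True
      show ?thesis
        unfolding eventually_at_right_field
      proof (intro exI[of _ 1] conjI allI impI)
        fix r :: real assume "0 < r"
        then show "(\<Sum>i\<in>UNIV. x $ i $ t + r * d $ i $ t) \<le> peak + r * e"
          using True dP[OF True] 
          by (simp add: P_def sum.distrib sum_distrib_left[symmetric])
      qed simp
    next
      case False
      have "((\<lambda>r. (\<Sum>i\<in>UNIV. x $ i $ t + r * d $ i $ t) - (peak + r * e)) \<longlongrightarrow>
          (\<Sum>i\<in>UNIV. x $ i $ t + 0 * d $ i $ t) - (peak + 0 * e)) (at_right 0)"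
        by (intro tendsto_intros)
      then have "\<forall>\<^sub>F r in at_right 0. (\<Sum>i\<in>UNIV. x $ i $ t + r * d $ i $ t) - (peak + r * e) < 0"
        by (rule order_tendstoD) (use False le_peak[of t] in \<open>simp add: P_def\<close>)
      then show ?thesis by eventually_elim simp
    qed
    have "\<forall>\<^sub>F r in at_right 0. h r \<le> h 0"
    proof -
      have "\<forall>\<^sub>F r in at_right 0. \<forall>l. (\<Sum>i\<in>UNIV. A $ l $ i \<bullet> (x $ i + r *\<^sub>R d $ i)) \<le> b $ l"
        by (intro eventually_all_finite evL)
      moreover have "\<forall>\<^sub>F r in at_right 0. \<forall>t. (\<Sum>i\<in>UNIV. x $ i $ t + r * d $ i $ t) \<le> peak + r * e"
        by (intro eventually_all_finite evP)
      ultimately show ?thesis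
      proof eventually_elim
        case (elim r)
        let ?x = "x + r *\<^sub>R d"
        have "?x \<in> feasible_set A b"
          using elim(1) by (simp add: feasible_set_def)
        then have "welfare v p p0 ?x \<le> welfare v p p0 x"
          using opt by (auto simp: optimal_allocation_def is_arg_max_def not_less)
        moreover have "Max (range (\<lambda>t. \<Sum>i\<in>UNIV. ?x $ i $ t)) \<le> peak + r * e"
          using elim(2) by simp
        then have "h r \<le> welfare v p p0 ?x"
          using \<open>p0 \<ge> 0\<close> by (simp add: welfare_eq_load h_def mult_left_mono)
        moreover have "welfare v p p0 x = h 0"
          by (simp add: welfare_eq_load h_def peak_def)
        ultimately show ?case by simp
      qed
    qed
    then obtain \<delta> where \<delta>: "\<delta> > 0" "\<And>r. 0 < r \<Longrightarrow> r < \<delta> \<Longrightarrow> h r \<le> h 0"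
      unfolding eventually_at_right_field by auto
    \<comment> \<open>A positive derivative would make \<open>h\<close> exceed \<open>h 0\<close>
      immediately to the right of 0.\<close>
    show ?thesis
    proof (rule ccontr)
      assume "\<not> ?thesis"
      then obtain \<epsilon> where \<epsilon>: "\<epsilon> > 0" "\<And>r. 0 < r \<Longrightarrow> r < \<epsilon> \<Longrightarrow> h 0 < h r"
        using DERIV_pos_inc_right[OF h'] by auto
      show False
        using \<delta>(2)[of "min \<delta> \<epsilon> / 2"] \<epsilon>(2)[of "min \<delta> \<epsilon> / 2"] \<open>\<delta> > 0\<close> \<open>\<epsilon> > 0\<close> by force
    qed
  qed
  then obtain c where c: "\<And>k. 0 \<le> c k" "g = (\<Sum>k\<in>L <+> P. c k *\<^sub>R w k)"
    using farkas[of "L <+> P" w g] by auto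
  have g: "g = (\<Sum>l\<in>L. c (Inl l) *\<^sub>R w (Inl l)) + (\<Sum>t\<in>P. c (Inr t) *\<^sub>R w (Inr t))"
    by (simp add: c(2) sum.Plus)
  \<comment> \<open>Extending the coefficients by 0 outside the active sets is complementary
    slackness.\<close>
  define q :: "real^'l" where "q = (\<chi> l. if l \<in> L then c (Inl l) else 0)"
  define \<pi> :: "real^'t" where "\<pi> = (\<chi> t. if t \<in> P then c (Inr t) else 0)"
  \<comment> \<open>In the peak coordinate each slot gradient has entry -1 and each row gradient 0,
    so the slot multipliers add up to \<open>p0\<close>.\<close>
  have "- p0 = snd g" by (simp add: g_def)
  also have "\<dots> = - (\<Sum>t\<in>P. c (Inr t))"
    by (simp add: g w_def snd_sum sum_negf)
  finally have sum_\<pi>: "(\<Sum>t\<in>UNIV. \<pi> $ t) = p0"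
    by (simp add: \<pi>_def sum.If_cases)
  have deriv_eq: "deriv (v i t) (x $ i $ t) = p $ t + \<pi> $ t + (\<Sum>l\<in>UNIV. q $ l * A $ l $ i $ t)" for i t
  proof -
    have "deriv (v i t) (x $ i $ t) - p $ t = fst g $ i $ t" by (simp add: g_def)
    also have "\<dots> = (\<Sum>l\<in>L. c (Inl l) * A $ l $ i $ t) + (\<Sum>t'\<in>P. if t' = t then c (Inr t') else 0)"
      by (simp add: g w_def fst_sum if_distrib eq_commute cong: if_cong)
    also have "\<dots> = (\<Sum>l\<in>UNIV. q $ l * A $ l $ i $ t) + \<pi> $ t"
      by (simp add: q_def \<pi>_def if_distrib[of "\<lambda>r. r * _"] sum.If_cases cong: if_cong)
    finally show ?thesis by simp
  qed
  show ?thesis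
  proof (rule that[of q \<pi>])
    show "0 \<le> q $ l" for l using c(1) by (simp add: q_def)
    show "0 \<le> \<pi> $ t" for t using c(1) by (simp add: \<pi>_def)
    show "(\<Sum>i\<in>UNIV. A $ l $ i \<bullet> x $ i) = b $ l" if "q $ l \<noteq> 0" for l
      using that by (cases "l \<in> L") (simp_all add: q_def L_def)
    show "(\<Sum>i\<in>UNIV. x $ i $ t) = peak" if "\<pi> $ t \<noteq> 0" for t
      using that by (cases "t \<in> P") (simp_all add: \<pi>_def P_def)
  qed (fact sum_\<pi> deriv_eq)+
qed

section \<open>Sufficiency of the Lagrangian conditions\<close>

definition net_utility ::
    "('n \<Rightarrow> 't::finite \<Rightarrow> real \<Rightarrow> real) \<Rightarrow> real^'t^'n^'l::finite \<Rightarrow> real^'t \<Rightarrow> real^'l \<Rightarrow> 'n \<Rightarrow> real^'t \<Rightarrow> real" where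
  "net_utility v A r q i y = utility v i y - r \<bullet> y - (\<Sum>l\<in>UNIV. q $ l * (A $ l $ i \<bullet> y))"

text \<open>Weak duality: the net utilities add up to a Lagrangian that bounds the welfare from
  above on feasible points, up to a constant, and complementary slackness makes the bound tight at
  \<open>x\<close>. Maximising user by user maximises the sum.\<close>

lemma optimal_allocation_if_net_utility_max:
  fixes v :: "'n::finite \<Rightarrow> 't::finite \<Rightarrow> real \<Rightarrow> real"
    and A :: "real^'t^'n^'l::finite" and q :: "real^'l"
  assumes feas: "x \<in> feasible_set A b"
    and q: "\<And>l. 0 \<le> q $ l"
    and \<pi>: "\<And>t. 0 \<le> \<pi> $ t" "(\<Sum>t\<in>UNIV. \<pi> $ t) = p0"
    and cq: "\<And>l. q $ l \<noteq> 0 \<Longrightarrow> (\<Sum>i\<in>UNIV. A $ l $ i \<bullet> x $ i) = b $ l"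
    and c\<pi>: "\<And>t. \<pi> $ t \<noteq> 0 \<Longrightarrow> (\<Sum>i\<in>UNIV. x $ i $ t) = Max (range (\<lambda>t. \<Sum>i\<in>UNIV. x $ i $ t))"
    and best: "\<And>i y. net_utility v A (p + \<pi>) q i y \<le> net_utility v A (p + \<pi>) q i (x $ i)"
  shows "optimal_allocation v p p0 A b x"
proof -
  define load where "load y t = (\<Sum>i\<in>UNIV. y $ i $ t)" for y :: "real^'t^'n" and t
  define con where "con y l = (\<Sum>i\<in>UNIV. A $ l $ i \<bullet> y $ i)" for y l
  have split: "(\<Sum>i\<in>UNIV. net_utility v A (p + \<pi>) q i (y $ i)) = welfare v p p0 y + p0 * Max (range (load y))
      - (\<Sum>t\<in>UNIV. \<pi> $ t * load y t) - (\<Sum>l\<in>UNIV. q $ l * con y l)" for y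
  proof -
    have "(\<Sum>i\<in>UNIV. z \<bullet> y $ i) = (\<Sum>t\<in>UNIV. z $ t * load y t)" for z
      unfolding load_def inner_vec_def by (subst sum.swap) (simp add: sum_distrib_left)
    moreover have "(\<Sum>i\<in>UNIV. \<Sum>l\<in>UNIV. q $ l * (A $ l $ i \<bullet> y $ i)) = (\<Sum>l\<in>UNIV. q $ l * con y l)"
      unfolding con_def by (subst sum.swap) (simp add: sum_distrib_left)
    ultimately show ?thesis
      unfolding net_utility_def welfare_def
      by (simp add: sum_subtractf inner_add_left sum.distrib load_def[symmetric])
  qed
  \<comment> \<open>Nonnegative weights of total \<open>p0\<close> charge at most \<open>p0\<close>
    times the largest load.\<close>
  have slack: "(\<Sum>t\<in>UNIV. \<pi> $ t * load y t) \<le> p0 * Max (range (load y))" for y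
    unfolding \<pi>(2)[symmetric] sum_distrib_right
    by (intro sum_mono mult_left_mono) (auto simp: \<pi>(1))
  have "\<pi> $ t * load x t = \<pi> $ t * Max (range (load x))" for t
    using c\<pi>[of t] unfolding load_def[abs_def] by (cases "\<pi> $ t = 0") simp_all
  then have tight: "(\<Sum>t\<in>UNIV. \<pi> $ t * load x t) = p0 * Max (range (load x))"
    unfolding \<pi>(2)[symmetric] sum_distrib_right by (intro sum.cong refl)
  have "q $ l * con x l = q $ l * b $ l" for l
    using cq[of l] unfolding con_def by (cases "q $ l = 0") simp_all
  then have tight': "(\<Sum>l\<in>UNIV. q $ l * con x l) = (\<Sum>l\<in>UNIV. q $ l * b $ l)"
    by (intro sum.cong refl)
  have "welfare v p p0 y \<le> welfare v p p0 x" if "y \<in> feasible_set A b" for y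
  proof -
    have "(\<Sum>l\<in>UNIV. q $ l * con y l) \<le> (\<Sum>l\<in>UNIV. q $ l * b $ l)"
      using that by (intro sum_mono mult_left_mono) (auto simp: q con_def feasible_set_def)
    moreover have "(\<Sum>i\<in>UNIV. net_utility v A (p + \<pi>) q i (y $ i)) \<le> (\<Sum>i\<in>UNIV. net_utility v A (p + \<pi>) q i (x $ i))"
      by (intro sum_mono best)
    ultimately show ?thesis
      using slack[of y] tight tight' by (simp add: split)
  qed
  with feas show ?thesis
    unfolding optimal_allocation_def is_arg_max_def by (auto simp: not_less)
qed

text \<open>The price and constraint terms are linear, so the objective separates into slots, and in
  each slot a concave function lies below its tangent.\<close>

lemma net_utility_max_if_first_order:
  fixes v :: "'n::finite \<Rightarrow> 't::finite \<Rightarrow> real \<Rightarrow> real"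
  assumes "\<And>t. strictly_concave (v i t)" "\<And>t z. v i t differentiable at z"
    and foc: "\<And>t. deriv (v i t) (x $ t) = r $ t + (\<Sum>l\<in>UNIV. q $ l * A $ l $ i $ t)"
  shows "net_utility v A r q i y \<le> net_utility v A r q i x"
proof -
  have "(\<Sum>l\<in>UNIV. q $ l * (A $ l $ i \<bullet> z)) = (\<Sum>t\<in>UNIV. (\<Sum>l\<in>UNIV. q $ l * A $ l $ i $ t) * z $ t)" for z
    unfolding inner_vec_def sum_distrib_left sum_distrib_right
    by (subst sum.swap) (simp add: mult.assoc)
  then have eq: "net_utility v A r q i z = (\<Sum>t\<in>UNIV. v i t (z $ t) - deriv (v i t) (x $ t) * z $ t)" for z
    by (simp add: net_utility_def utility_def inner_vec_def foc sum_subtractf sum.distrib distrib_right)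
  show ?thesis
    unfolding eq
  proof (intro sum_mono)
    fix t
    have "v i t (y $ t) \<le> v i t (x $ t) + deriv (v i t) (x $ t) * (y $ t - x $ t)"
      using assms(1,2) by (rule strictly_concave_tangent)
    then show "v i t (y $ t) - deriv (v i t) (x $ t) * y $ t
        \<le> v i t (x $ t) - deriv (v i t) (x $ t) * x $ t"
      by (simp add: right_diff_distrib)
  qed
qed

section \<open>Existence and uniqueness of the optimal allocation\<close>

lemma continuous_on_Max_image:
  fixes f :: "'a::topological_space \<Rightarrow> 'k \<Rightarrow> real"
  assumes "finite I" "I \<noteq> {}" "\<And>k. k \<in> I \<Longrightarrow> continuous_on S (\<lambda>x. f x k)"
  shows "continuous_on S (\<lambda>x. Max (f x ` I))"
  using assms
proof (induction I rule: finite_ne_induct)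
  case (insert k I)
  then have "continuous_on S (\<lambda>x. max (f x k) (Max (f x ` I)))"
    by (intro continuous_on_max) auto
  with insert.hyps show ?case by simp
qed simp

lemma optimal_allocation_exists:
  fixes v :: "'n::finite \<Rightarrow> 't::finite \<Rightarrow> real \<Rightarrow> real"
    and A :: "real^'t^'n^'l::finite"
  assumes cont: "\<And>i t. continuous_on UNIV (v i t)"
    and "compact (feasible_set A b)" "\<And>l. b $ l \<ge> 0"
  shows "\<exists>x. optimal_allocation v p p0 A b x"
proof -
  \<comment> \<open>Nonnegativity of \<open>b\<close> makes the compact feasible set nonempty, so
    the continuous welfare attains its maximum.\<close>
  have "0 \<in> feasible_set A b"
    using assms(3) by (simp add: feasible_set_def)
  moreover have "continuous_on (feasible_set A b) (welfare v p p0)"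
    unfolding welfare_def utility_def
    by (intro continuous_intros continuous_on_Max_image
        continuous_on_compose2[OF cont]) auto
  ultimately obtain x where "x \<in> feasible_set A b"
      "\<And>y. y \<in> feasible_set A b \<Longrightarrow> welfare v p p0 y \<le> welfare v p p0 x"
    using continuous_attains_sup[OF \<open>compact (feasible_set A b)\<close>] by blast
  then show ?thesis
    unfolding optimal_allocation_def is_arg_max_def by (auto simp: not_less)
qed

text \<open>If two maximisers differed, their midpoint would be feasible and strictly better: some
  utility term gains strictly, the energy cost is linear, and the peak is convex.\<close>

lemma optimal_allocation_unique:
  fixes v :: "'n::finite \<Rightarrow> 't::finite \<Rightarrow> real \<Rightarrow> real"
    and A :: "real^'t^'n^'l::finite"
  assumes conc: "\<And>i t. strictly_concave (v i t)" and "p0 \<ge> 0"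
    and x: "optimal_allocation v p p0 A b x" and y: "optimal_allocation v p p0 A b y"
  shows "x = y"
proof (rule ccontr)
  assume "x \<noteq> y"
  define m where "m = (1/2) *\<^sub>R x + (1/2) *\<^sub>R y"
  have m_nth: "m $ i $ t = x $ i $ t / 2 + y $ i $ t / 2" for i t
    by (simp add: m_def)
  have feas: "x \<in> feasible_set A b" "y \<in> feasible_set A b"
    and eq: "welfare v p p0 x = welfare v p p0 y"
    and max: "\<And>z. z \<in> feasible_set A b \<Longrightarrow> welfare v p p0 z \<le> welfare v p p0 x"
    using x y by (auto simp: optimal_allocation_def is_arg_max_def not_less intro: antisym)
  have "m \<in> feasible_set A b"
  proof -
    have "(\<Sum>i\<in>UNIV. A $ l $ i \<bullet> m $ i)
        = (\<Sum>i\<in>UNIV. A $ l $ i \<bullet> x $ i) / 2 + (\<Sum>i\<in>UNIV. A $ l $ i \<bullet> y $ i) / 2" for l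
      by (simp add: m_def inner_add_right sum.distrib sum_divide_distrib)
    moreover have "(\<Sum>i\<in>UNIV. A $ l $ i \<bullet> x $ i) / 2 + (\<Sum>i\<in>UNIV. A $ l $ i \<bullet> y $ i) / 2 \<le> b $ l" for l
    proof -
      have "(\<Sum>i\<in>UNIV. A $ l $ i \<bullet> x $ i) \<le> b $ l" "(\<Sum>i\<in>UNIV. A $ l $ i \<bullet> y $ i) \<le> b $ l"
        using feas by (auto simp: feasible_set_def)
      then show ?thesis by linarith
    qed
    ultimately show ?thesis
      by (simp add: feasible_set_def)
  qed
  have le: "v i t (x $ i $ t) / 2 + v i t (y $ i $ t) / 2 \<le> v i t (m $ i $ t)"
    and less: "x $ i $ t \<noteq> y $ i $ t \<Longrightarrow> v i t (x $ i $ t) / 2 + v i t (y $ i $ t) / 2 < v i t (m $ i $ t)"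
    for i t
    using conc[of i t, unfolded strictly_concave_def, rule_format, of "x $ i $ t" "y $ i $ t" "1/2"]
    by (cases "x $ i $ t = y $ i $ t"; simp add: m_nth)+
  have le_i: "utility v i (x $ i) / 2 + utility v i (y $ i) / 2 \<le> utility v i (m $ i)" for i
    unfolding utility_def sum_divide_distrib sum.distrib[symmetric] by (intro sum_mono le)
  obtain i where "x $ i \<noteq> y $ i" using \<open>x \<noteq> y\<close> by (auto simp: vec_eq_iff)
  then obtain t where "x $ i $ t \<noteq> y $ i $ t" by (auto simp: vec_eq_iff)
  then have "utility v i (x $ i) / 2 + utility v i (y $ i) / 2 < utility v i (m $ i)"
    unfolding utility_def sum_divide_distrib sum.distrib[symmetric]
    using le by (intro sum_strict_mono_ex1 bexI[of _ t] ballI less) auto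
  then have "(\<Sum>i\<in>UNIV. utility v i (x $ i) / 2 + utility v i (y $ i) / 2) < (\<Sum>i\<in>UNIV. utility v i (m $ i))"
    using le_i by (intro sum_strict_mono_ex1 bexI[of _ i] ballI) auto
  moreover have "(\<Sum>t\<in>UNIV. p $ t * (\<Sum>i\<in>UNIV. m $ i $ t))
      = (\<Sum>t\<in>UNIV. p $ t * (\<Sum>i\<in>UNIV. x $ i $ t)) / 2 + (\<Sum>t\<in>UNIV. p $ t * (\<Sum>i\<in>UNIV. y $ i $ t)) / 2"
    by (simp add: m_nth sum.distrib sum_divide_distrib[symmetric] distrib_left)
  moreover have "Max (range (\<lambda>t. \<Sum>i\<in>UNIV. m $ i $ t))
      \<le> Max (range (\<lambda>t. \<Sum>i\<in>UNIV. x $ i $ t)) / 2 + Max (range (\<lambda>t. \<Sum>i\<in>UNIV. y $ i $ t)) / 2"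
    (is "_ \<le> ?X / 2 + ?Y / 2")
  proof (rule Max.boundedI)
    fix r assume "r \<in> range (\<lambda>t. \<Sum>i\<in>UNIV. m $ i $ t)"
    then obtain t where r: "r = (\<Sum>i\<in>UNIV. x $ i $ t) / 2 + (\<Sum>i\<in>UNIV. y $ i $ t) / 2"
      by (auto simp: m_nth sum.distrib sum_divide_distrib[symmetric])
    have "(\<Sum>i\<in>UNIV. x $ i $ t) \<le> ?X" "(\<Sum>i\<in>UNIV. y $ i $ t) \<le> ?Y"
      by simp_all
    with r show "r \<le> ?X / 2 + ?Y / 2" by linarith
  qed auto
  from mult_left_mono[OF this \<open>p0 \<ge> 0\<close>]
  have "p0 * Max (range (\<lambda>t. \<Sum>i\<in>UNIV. m $ i $ t))
      \<le> p0 * Max (range (\<lambda>t. \<Sum>i\<in>UNIV. x $ i $ t)) / 2 + p0 * Max (range (\<lambda>t. \<Sum>i\<in>UNIV. y $ i $ t)) / 2"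
    by (simp only: distrib_left times_divide_eq_right)
  ultimately have "welfare v p p0 x / 2 + welfare v p p0 y / 2 < welfare v p p0 m"
    unfolding welfare_def sum.distrib sum_divide_distrib[symmetric]
    by (simp only: diff_divide_distrib)
  with max[OF \<open>m \<in> feasible_set A b\<close>] eq show False by simp
qed


section \<open>Sums over trees\<close>

text \<open>Loops are cut out as the path grows: if the next vertex already occurs on it, the path
  is truncated at that occurrence.\<close>

lemma rtranclp_imp_distinct_path:
  assumes "R\<^sup>*\<^sup>* x y"
  shows "\<exists>xs. xs \<noteq> [] \<and> distinct xs \<and> successively R xs \<and> hd xs = x \<and> last xs = y"
  using assms
proof (induction rule: rtranclp_induct)
  case base
  show ?case by (intro exI[of _ "[x]"]) simp
next
  case (step y z)
  then obtain xs where xs: "xs \<noteq> []" "distinct xs" "successively R xs" "hd xs = x" "last xs = y"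
    by blast
  show ?case
  proof (cases "z \<in> set xs")
    case True
    then obtain us ws where split: "xs = us @ z # ws" by (meson split_list)
    then have "successively R ((us @ [z]) @ ws)" using xs(3) by simp
    then have "successively R (us @ [z])" by (simp only: successively_append_iff)
    moreover have "hd (us @ [z]) = x" using xs(4) split by (cases us) simp_all
    moreover have "distinct (us @ [z])" using xs(2) split by simp
    ultimately show ?thesis by (intro exI[of _ "us @ [z]"]) simp
  next
    case False
    with xs step.hyps show ?thesis
      by (intro exI[of _ "xs @ [z]"]) (auto simp: successively_append_iff)
  qed
qed

text \<open>The parent of a vertex is a neighbour closer to the root. An edge that is not a parent
  edge would close a cycle with parent paths from its two ends.\<close>

lemma tree_graph_rooted:
  fixes E :: "'n::finite \<Rightarrow> 'n \<Rightarrow> bool"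
  assumes "tree_graph E"
  shows "\<exists>par. \<exists>depth :: 'n \<Rightarrow> nat. (\<forall>j. j \<noteq> r \<longrightarrow> E j (par j) \<and> depth (par j) < depth j) \<and>
    (\<forall>i j. E i j \<longleftrightarrow> (i \<noteq> r \<and> j = par i) \<or> (j \<noteq> r \<and> i = par j))"
proof -
  have sym: "E i j \<Longrightarrow> E j i" and conn: "E\<^sup>*\<^sup>* i j" and irrefl: "\<not> E i i"
    and acyc: "\<not> simple_cycle E c" for i j c
    using assms by (auto simp: tree_graph_def dest: sympD irreflpD)
  \<comment> \<open>The distance to the root, finite by connectivity.\<close>
  define depth where "depth j = (LEAST n. (E ^^ n) j r)" for j
  have depth: "(E ^^ depth j) j r" for j
    unfolding depth_def using conn[of j r] by (auto simp: rtranclp_power intro: LeastI)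
  have "\<exists>k. E j k \<and> depth k < depth j" if ne: "j \<noteq> r" for j
  proof -
    obtain n where n: "depth j = Suc n"
      using depth[of j] ne by (cases "depth j") auto
    then obtain k where "E j k" "(E ^^ n) k r"
      using depth[of j] n relpowp_Suc_D2[of n E j r] by auto
    then have "depth k \<le> n" unfolding depth_def by (intro Least_le)
    with \<open>E j k\<close> n show ?thesis by auto
  qed
  then obtain par where par: "\<And>j. j \<noteq> r \<Longrightarrow> E j (par j) \<and> depth (par j) < depth j"
    by metis
  have "(i \<noteq> r \<and> j = par i) \<or> (j \<noteq> r \<and> i = par j)" if "E i j" for i j
  proof (rule ccontr)
    assume non: "\<not> ?thesis"
    \<comment> \<open>The graph without the supposed extra edge. All parent edges survive in it, so
      its ends are still joined through the root.\<close>
    define E' where "E' x y \<longleftrightarrow> E x y \<and> {x, y} \<noteq> {i, j}" for x y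
    have E'_par: "E' k (par k)" if "k \<noteq> r" for k
      using par[OF that] that non by (auto simp: E'_def doubleton_eq_iff)
    have to_root: "E'\<^sup>*\<^sup>* k r" for k
    proof (induction k rule: measure_induct_rule[of depth])
      case (less k)
      then show ?case
        using E'_par[of k] par[of k] by (cases "k = r") (auto intro: converse_rtranclp_into_rtranclp)
    qed
    have "symp E'"
      by (auto simp: symp_def E'_def insert_commute intro: sym)
    then have "E'\<^sup>*\<^sup>* r j"
      using to_root[of j] by (metis sympD symp_rtranclp)
    with to_root[of i] have "E'\<^sup>*\<^sup>* i j" by simp
    then obtain xs where xs: "xs \<noteq> []" "distinct xs" "successively E' xs" "hd xs = i" "last xs = j"
      using rtranclp_imp_distinct_path by metis
    \<comment> \<open>A shorter path would be a single vertex, making the edge a loop, or the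
      deleted edge itself.\<close>
    have "3 \<le> length xs"
    proof (rule ccontr)
      assume "\<not> 3 \<le> length xs"
      with \<open>xs \<noteq> []\<close> consider a where "xs = [a]" | a c where "xs = [a, c]"
        by (cases xs rule: remdups_adj.cases) (auto simp: Suc_le_eq)
      then show False
        using xs irrefl[of i] \<open>E i j\<close> by cases (auto simp: E'_def)
    qed
    moreover have "successively E xs"
      using xs(3) by (rule successively_mono) (simp add: E'_def)
    ultimately have "simple_cycle E xs"
      using xs sym[OF \<open>E i j\<close>] by (simp add: simple_cycle_def)
    with acyc show False by blast
  qed
  with par sym show ?thesis
    by (intro exI[of _ par] exI[of _ depth]) blast
qed

text \<open>Rooting the tree at any vertex, \<open>D j\<close> is the sum of \<open>g\<close> over the subtree below \<open>j\<close>.\<close>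

lemma tree_branch_sums_exist:
  fixes E :: "'n::finite \<Rightarrow> 'n \<Rightarrow> bool" and g :: "'n \<Rightarrow> 'a::ab_group_add"
  assumes "tree_graph E"
  shows "\<exists>f. \<forall>i j. E i j \<longrightarrow> f i j = g j + (\<Sum>h\<in>nbrs E j - {i}. f j h)"
proof -
  obtain r :: 'n where True by simp
  obtain par and depth :: "'n \<Rightarrow> nat"
    where *: "\<forall>j. j \<noteq> r \<longrightarrow> E j (par j) \<and> depth (par j) < depth j"
      "\<forall>i j. E i j \<longleftrightarrow> (i \<noteq> r \<and> j = par i) \<or> (j \<noteq> r \<and> i = par j)"
    using tree_graph_rooted[OF assms, of r] by (elim exE conjE)
  have par: "j \<noteq> r \<Longrightarrow> E j (par j) \<and> depth (par j) < depth j"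
    and edge: "E i j \<longleftrightarrow> (i \<noteq> r \<and> j = par i) \<or> (j \<noteq> r \<and> i = par j)" for i j
    using * by simp_all
  define chd where "chd j = {h. h \<noteq> r \<and> par h = j}" for j
  define R where "R = {(h, j). h \<in> chd j}"
  \<comment> \<open>The depth decreases towards the root, whereas the recursion runs towards the
    leaves. Finiteness carries well-foundedness over to the opposite direction.\<close>
  have "wf (R\<inverse>)"
    by (rule wf_subset[OF wf_measure[of depth]]) (auto simp: R_def chd_def par)
  then have "wf R"
    using wf_acyclic by (intro finite_acyclic_wf) (auto simp: acyclic_converse)
  define D where "D = wfrec R (\<lambda>F j. g j + (\<Sum>h\<in>chd j. F h))"
  have D: "D j = g j + (\<Sum>h\<in>chd j. D h)" for j
    unfolding D_def by (subst wfrec[OF \<open>wf R\<close>]) (simp add: cut_def R_def)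
  have depth_par: "j = r \<or> depth (par j) < depth j" for j using par by blast
  \<comment> \<open>The branch behind \<open>j\<close> as seen from \<open>i\<close>: the subtree of
    \<open>j\<close> if \<open>i\<close> is its parent, and otherwise everything outside the subtree
    of \<open>i\<close>.\<close>
  define f where "f i j = (if j \<noteq> r \<and> i = par j then D j else D r - D i)" for i j
  have f_chd: "(\<Sum>h\<in>C. f j h) = (\<Sum>h\<in>C. D h)" if "C \<subseteq> chd j" for C j
    using that by (intro sum.cong) (auto simp: f_def chd_def)
  have f_par: "f j (par j) = D r - D j" if "j \<noteq> r" for j
    using depth_par[of j] depth_par[of "par j"] that by (auto simp: f_def)
  have nbrs: "nbrs E j = chd j \<union> (if j = r then {} else {par j})" for j
    by (auto simp: nbrs_def edge chd_def)
  have not_chd: "par j \<notin> chd j" if "j \<noteq> r" for j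
    using depth_par[of j] depth_par[of "par j"] that by (auto simp: chd_def)
  have "f i j = g j + (\<Sum>h\<in>nbrs E j - {i}. f j h)" if "E i j" for i j
  proof (cases "j \<noteq> r \<and> i = par j")
    case True
    then have "nbrs E j - {i} = chd j" using not_chd[of j] by (auto simp: nbrs)
    moreover have "f i j = D j" using True by (simp add: f_def)
    ultimately show ?thesis using D[of j] by (simp only: f_chd[OF subset_refl])
  next
    case False
    with that have i: "i \<noteq> r" "j = par i" by (auto simp: edge)
    then have "i \<in> chd j" by (simp add: chd_def)
    then have D_rest: "D j = g j + D i + (\<Sum>h\<in>chd j - {i}. D h)"
      using D[of j] sum.remove[of "chd j" i D] by simp
    show ?thesis
    proof (cases "j = r")
      case True
      then have "nbrs E j - {i} = chd j - {i}" by (auto simp: nbrs)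
      then show ?thesis using D_rest f_par[OF i(1)] i(2) True by (simp add: f_chd algebra_simps)
    next
      case False
      have "nbrs E j - {i} = insert (par j) (chd j - {i})"
        using False \<open>i \<in> chd j\<close> not_chd[of j] by (auto simp: nbrs)
      then have "(\<Sum>h\<in>nbrs E j - {i}. f j h) = D r - D j + (\<Sum>h\<in>chd j - {i}. D h)"
        using not_chd[of j] False by (simp add: f_chd f_par)
      moreover have "f i j = D r - D i" using f_par[OF i(1)] i(2) by simp
      ultimately show ?thesis by (simp add: D_rest)
    qed
  qed
  then show ?thesis by blast
qed

text \<open>Root the tree at \<open>i\<close>: summing the recursion over all vertices, every non-root value occurs
  once on each side and cancels.\<close>

lemma tree_branch_sums_total:
  fixes E :: "'n::finite \<Rightarrow> 'n \<Rightarrow> bool" and g :: "'n \<Rightarrow> 'a::ab_group_add"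
  assumes "tree_graph E"
    and f: "\<And>i j. E i j \<Longrightarrow> f i j = g j + (\<Sum>h\<in>nbrs E j - {i}. f j h)"
  shows "g i + (\<Sum>j\<in>nbrs E i. f i j) = (\<Sum>k\<in>UNIV. g k)"
proof -
  let ?r = i
  obtain par and depth :: "'n \<Rightarrow> nat"
    where *: "\<forall>j. j \<noteq> ?r \<longrightarrow> E j (par j) \<and> depth (par j) < depth j"
      "\<forall>i j. E i j \<longleftrightarrow> (i \<noteq> ?r \<and> j = par i) \<or> (j \<noteq> ?r \<and> i = par j)"
    using tree_graph_rooted[OF assms(1), of ?r] by (elim exE conjE)
  have par: "j \<noteq> ?r \<Longrightarrow> E j (par j) \<and> depth (par j) < depth j"
    and edge: "E i j \<longleftrightarrow> (i \<noteq> ?r \<and> j = par i) \<or> (j \<noteq> ?r \<and> i = par j)" for i j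
    using * by simp_all
  define chd where "chd j = {h. h \<noteq> ?r \<and> par h = j}" for j
  have depth_par: "j = ?r \<or> depth (par j) < depth j" for j using par by blast
  have nbrs: "nbrs E j = chd j \<union> (if j = ?r then {} else {par j})" for j
    by (auto simp: nbrs_def edge chd_def)
  have not_chd: "par j \<notin> chd j" if "j \<noteq> ?r" for j
    using depth_par[of j] depth_par[of "par j"] that by (auto simp: chd_def)
  \<comment> \<open>Only branch values pointing away from the root are kept; at the root itself,
    \<open>D\<close> is the quantity to be computed.\<close>
  define D where "D j = (if j = ?r then g ?r + (\<Sum>j\<in>nbrs E ?r. f ?r j) else f (par j) j)" for j
  have D: "D j = g j + (\<Sum>h\<in>chd j. D h)" for j
  proof -
    have "(\<Sum>h\<in>chd j. D h) = (\<Sum>h\<in>chd j. f j h)"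
      by (intro sum.cong) (auto simp: D_def chd_def)
    moreover have "nbrs E j - {par j} = chd j" if "j \<noteq> ?r"
      using that not_chd[of j] by (auto simp: nbrs)
    moreover have "E (par j) j" if "j \<noteq> ?r" using that by (simp add: edge)
    ultimately show ?thesis
      using f[of "par j" j] by (simp add: D_def nbrs)
  qed
  have "(\<Sum>j\<in>UNIV. D j) = (\<Sum>j\<in>UNIV. g j) + (\<Sum>j\<in>UNIV. \<Sum>h\<in>chd j. D h)"
    by (subst D) (simp add: sum.distrib)
  \<comment> \<open>Each vertex other than the root is a child of exactly one vertex.\<close>
  also have "(\<Sum>j\<in>UNIV. \<Sum>h\<in>chd j. D h) = (\<Sum>h\<in>UNIV - {?r}. D h)"
    using sum.group[of "UNIV - {?r}" UNIV par D] by (simp add: chd_def Diff_eq Collect_conj_eq Collect_neg_eq Int_commute)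
  also have "(\<Sum>j\<in>UNIV. D j) = D ?r + (\<Sum>h\<in>UNIV - {?r}. D h)"
    by (simp add: sum.remove)
  finally show ?thesis by (simp add: D_def)
qed

section \<open>Consensus of local averages\<close>

text \<open>Completing the square shows that \<open>q\<close> is the projection of
  \<open>a - c / 2\<close> onto the nonnegative half-line.\<close>

lemma penalty_minimizer:
  fixes q a c :: real
  assumes "0 \<le> q" and min: "\<And>r. 0 \<le> r \<Longrightarrow> (q - a)\<^sup>2 + q * c \<le> (r - a)\<^sup>2 + r * c"
  shows "q = max 0 (a - c / 2)"
proof -
  have "(q - (a - c / 2))\<^sup>2 \<le> (r - (a - c / 2))\<^sup>2" if "0 \<le> r" for r
    using min[OF that] by (simp add: power2_eq_square algebra_simps)
  from this[of "max 0 (a - c / 2)"] have *: "(q - (a - c / 2))\<^sup>2 \<le> (max 0 (a - c / 2) - (a - c / 2))\<^sup>2"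
    by simp
  show ?thesis
  proof (cases "0 \<le> a - c / 2")
    case True
    with * show ?thesis by (simp add: max_def)
  next
    case False
    with * have "(q - (a - c / 2))\<^sup>2 \<le> (- (a - c / 2))\<^sup>2"
      by (simp add: max_def)
    then have "q - (a - c / 2) \<le> - (a - c / 2)"
      by (rule power2_le_imp_le) (use False in simp)
    with False \<open>0 \<le> q\<close> show ?thesis by (simp add: max_def)
  qed
qed

lemma average_le:
  fixes q :: "'n \<Rightarrow> real"
  assumes "finite S" "S \<noteq> {}" "\<And>j. j \<in> S \<Longrightarrow> q j \<le> M"
  shows "1 / real (card S) * (\<Sum>j\<in>S. q j) \<le> M"
proof -
  have "(\<Sum>j\<in>S. q j) \<le> real (card S) * M" using assms sum_bounded_above by metis
  with assms show ?thesis by (simp add: field_simps card_gt_0_iff)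
qed

lemma average_ge:
  fixes q :: "'n \<Rightarrow> real"
  assumes "finite S" "S \<noteq> {}" "\<And>j. j \<in> S \<Longrightarrow> M \<le> q j"
  shows "M \<le> 1 / real (card S) * (\<Sum>j\<in>S. q j)"
proof -
  have "real (card S) * M \<le> (\<Sum>j\<in>S. q j)" using assms sum_bounded_below by metis
  with assms show ?thesis by (simp add: field_simps card_gt_0_iff)
qed

text \<open>A discrete maximum principle: extremal users settle the sign of \<open>c\<close>, and
  for \<open>c = 0\<close> the values are harmonic on a connected graph, hence constant.\<close>

lemma average_consensus:
  fixes E :: "'n::finite \<Rightarrow> 'n \<Rightarrow> bool" and q :: "'n \<Rightarrow> real"
  assumes conn: "\<And>i j. E\<^sup>*\<^sup>* i j" and ne: "\<And>i. nbrs E i \<noteq> {}"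
    and q: "\<And>i. q i = max 0 (1 / real (card (nbrs E i)) * (\<Sum>j\<in>nbrs E i. q j) - c / 2)"
  shows "0 \<le> c" and "q i = q j" and "q i \<noteq> 0 \<Longrightarrow> c = 0"
proof -
  let ?avg = "\<lambda>i. 1 / real (card (nbrs E i)) * (\<Sum>j\<in>nbrs E i. q j)"
  have nonneg: "0 \<le> q i" for i by (subst q) simp
  obtain lo where "q lo = Min (range q)"
    using Min_in[of "range q"] by (metis finite_imageI finite_class.finite_UNIV image_iff UNIV_not_empty image_is_empty)
  then have lo: "q lo \<le> q k" for k by simp
  \<comment> \<open>For negative \<open>c\<close> the smallest value would exceed its neighbourhood
    average, which is at least as large as that value.\<close>
  show "0 \<le> c"
  proof (rule ccontr)
    assume "\<not> 0 \<le> c"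
    moreover have "q lo \<le> ?avg lo" by (intro average_ge ne lo) simp
    ultimately show False using q[of lo] by simp
  qed
  obtain hi where "q hi = Max (range q)"
    using Max_in[of "range q"] by (metis finite_imageI finite_class.finite_UNIV image_iff UNIV_not_empty image_is_empty)
  then have hi: "q k \<le> q hi" for k by simp
  have avg_hi: "?avg k \<le> q hi" for k by (intro average_le ne hi) simp
  \<comment> \<open>For positive \<open>c\<close> the shifted average at \<open>hi\<close> lies
    below \<open>q hi\<close>, so the maximum with 0 is attained at 0 and all values vanish.\<close>
  have zero: "q k = 0" if "c > 0" for k
    using q[of hi] avg_hi[of hi] that hi[of k] nonneg[of k] by (auto simp: max_def split: if_splits)
  show zero_c: "c = 0" if "q i \<noteq> 0"
    using zero[of i] that \<open>0 \<le> c\<close> by linarith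
  show "q i = q j"
  proof (cases "c = 0")
    case True
    have const: "q k = q hi" if "E\<^sup>*\<^sup>* hi k" for k
      using that
    proof (induction rule: rtranclp_induct)
      case (step k h)
      have "h \<in> nbrs E k" using step by (simp add: nbrs_def)
      have "?avg k \<ge> q hi"
        using q[of k] step.IH True average_ge[of "nbrs E k" 0 q] nonneg ne by simp
      then have "real (card (nbrs E k)) * q hi \<le> (\<Sum>j\<in>nbrs E k. q j)"
        using ne[of k] by (simp add: field_simps card_gt_0_iff)
      \<comment> \<open>The deficits \<open>q hi - q j\<close> are nonnegative, so each of them
        vanishes and the maximal value spreads to every neighbour of \<open>k\<close>.\<close>
      then have "(\<Sum>j\<in>nbrs E k. q hi - q j) \<le> 0" by (simp add: sum_subtractf)
      moreover have "q hi - q h \<le> (\<Sum>j\<in>nbrs E k. q hi - q j)"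
        using \<open>h \<in> nbrs E k\<close> hi by (intro member_le_sum) auto
      ultimately show ?case using hi[of h] by simp
    qed simp
    show ?thesis using const[OF conn, of i] const[OF conn, of j] by simp
  next
    case False
    then show ?thesis using zero_c zero \<open>0 \<le> c\<close> by (metis order_less_le)
  qed
qed


section \<open>Equilibria of the mechanism\<close>

definition deviation :: "'j set \<Rightarrow> ('j \<Rightarrow> real^'k) \<Rightarrow> ('j \<Rightarrow> real^'k) \<Rightarrow> real" where
  "deviation J x y = (\<Sum>k\<in>UNIV. \<Sum>j\<in>J. (x j $ k - y j $ k)\<^sup>2)"

definition price_penalty :: "real^'k \<Rightarrow> real^'k \<Rightarrow> real^'k \<Rightarrow> real" where
  "price_penalty c a x = (\<Sum>k\<in>UNIV. (x $ k - a $ k)\<^sup>2 + x $ k * c $ k)"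

text \<open>The slack of each constraint as perceived by user \<open>i\<close>, with its own demand
  replaced by the proxy \<open>msg_beta\<close> reported by \<open>\<phi> i\<close>.\<close>

definition con_gap where
  "con_gap E A b \<phi> m i = (\<chi> l. b $ l - (\<Sum>j\<in>nbrs E i. f_con E A m i j $ l) - A $ l $ i \<bullet> msg_beta (m (\<phi> i)) i)"

definition dem_gap where
  "dem_gap E \<phi> m i = (\<chi> t. zeta_max E \<phi> m i - zeta E \<phi> m i $ t)"

lemma deviation_nonneg: "0 \<le> deviation J x y"
  by (simp add: deviation_def sum_nonneg)

lemma deviation_eq_0: "finite J \<Longrightarrow> deviation J x y = 0 \<longleftrightarrow> (\<forall>j\<in>J. x j = y j)"
  by (auto simp: deviation_def sum_nonneg_eq_0_iff sum_nonneg vec_eq_iff)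

text \<open>The penalty is a sum over coordinates that can be varied independently, so the scalar
  projection formula applies to each.\<close>

lemma price_penalty_minimizer_iff:
  fixes c a x :: "real^'k::finite"
  assumes "\<And>k. 0 \<le> x $ k"
  shows "(\<forall>y. (\<forall>k. 0 \<le> y $ k) \<longrightarrow> price_penalty c a x \<le> price_penalty c a y)
    \<longleftrightarrow> (\<forall>k. x $ k = max 0 (a $ k - c $ k / 2))" (is "?L \<longleftrightarrow> ?R")
proof
  assume L: ?L
  show ?R
  proof
    fix k
    show "x $ k = max 0 (a $ k - c $ k / 2)"
    proof (rule penalty_minimizer[OF assms])
      fix r :: real
      assume "0 \<le> r"
      define y where "y = (\<chi> k'. if k' = k then r else x $ k')"
      have "price_penalty c a x \<le> price_penalty c a y"
        using L \<open>0 \<le> r\<close> assms by (simp add: y_def)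
      moreover have split: "price_penalty c a z = (z $ k - a $ k)\<^sup>2 + z $ k * c $ k
          + (\<Sum>k'\<in>UNIV - {k}. (z $ k' - a $ k')\<^sup>2 + z $ k' * c $ k')" for z
        unfolding price_penalty_def by (rule sum.remove) auto
      moreover have "(\<Sum>k'\<in>UNIV - {k}. (y $ k' - a $ k')\<^sup>2 + y $ k' * c $ k')
          = (\<Sum>k'\<in>UNIV - {k}. (x $ k' - a $ k')\<^sup>2 + x $ k' * c $ k')"
        by (intro sum.cong) (auto simp: y_def)
      ultimately show "(x $ k - a $ k)\<^sup>2 + x $ k * c $ k \<le> (r - a $ k)\<^sup>2 + r * c $ k"
        by (simp add: y_def)
    qed
  qed
next
  assume R: ?R
  have "(x $ k - a $ k)\<^sup>2 + x $ k * c $ k \<le> (r - a $ k)\<^sup>2 + r * c $ k" if "0 \<le> r" for r k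
  proof (cases "0 \<le> a $ k - c $ k / 2")
    case True
    then have c: "c $ k = 2 * (a $ k - x $ k)" using R by simp
    then have "(r - a $ k)\<^sup>2 + r * c $ k - ((x $ k - a $ k)\<^sup>2 + x $ k * c $ k) = (r - x $ k)\<^sup>2"
      unfolding c by (simp add: power2_eq_square algebra_simps)
    then show ?thesis using zero_le_power2[of "r - x $ k"] by linarith
  next
    case False
    then have "x $ k = 0" using R by simp
    \<comment> \<open>At the boundary solution 0 this product is exactly the excess penalty of
      \<open>r\<close>.\<close>
    moreover have "0 \<le> r * (r + (c $ k - 2 * a $ k))"
      using False that by (intro mult_nonneg_nonneg) auto
    ultimately show ?thesis by (simp add: power2_eq_square algebra_simps)
  qed
  then show ?L unfolding price_penalty_def by (auto intro: sum_mono)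
qed

text \<open>Every quantity taken from the neighbours is unaffected by the user's own deviation, so the
  payoff separates into one term per message component.\<close>

lemma payoff_deviate:
  fixes v :: "'n::finite \<Rightarrow> 't::finite \<Rightarrow> real \<Rightarrow> real"
    and A :: "real^'t^'n^'l::finite"
  assumes irrefl: "\<And>j. \<not> E j j" and \<phi>: "\<And>j. \<phi> j \<in> nbrs E j"
  shows "payoff v p p0 A b E \<phi> i (m(i := d)) =
     net_utility v A (p + radial_pricing p0 (s_avg E m i) (zeta E \<phi> m i)) (q_avg E m i) i (msg_y d)
     - deviation (nbrs E i) (msg_n d) (f_con E A m i)
     - deviation (nbrs E i) (msg_nu d) (f_dem E m i)
     - deviation {j. \<phi> j = i} (msg_beta d) (\<lambda>j. msg_y (m j))
     - price_penalty (con_gap E A b \<phi> m i) (q_avg E m i) (msg_q d)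
     - price_penalty (dem_gap E \<phi> m i) (s_avg E m i) (msg_s d)"
proof -
  let ?m = "m(i := d)"
  have nb: "j \<noteq> i" if "j \<in> nbrs E i" for j using that irrefl by (auto simp: nbrs_def)
  have \<phi>_ne: "\<phi> j \<noteq> j" for j using \<phi>[of j] irrefl by (auto simp: nbrs_def)
  have [simp]: "f_con E A ?m i j = f_con E A m i j" "f_dem E ?m i j = f_dem E m i j"
    "?m j = m j" if "j \<in> nbrs E i" for j
    using nb[OF that] by (simp_all add: f_con_def f_dem_def)
  have [simp]: "s_avg E ?m i = s_avg E m i" "q_avg E ?m i = q_avg E m i"
    by (simp_all add: s_avg_def q_avg_def nb cong: sum.cong_simp)
  have [simp]: "zeta E \<phi> ?m i = zeta E \<phi> m i" "?m (\<phi> i) = m (\<phi> i)"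
    by (simp_all add: zeta_def \<phi>_ne cong: sum.cong_simp)
  have [simp]: "zeta_max E \<phi> ?m i = zeta_max E \<phi> m i" "allocation ?m $ i = msg_y d"
    by (simp_all add: zeta_max_def allocation_def)
  have [simp]: "?m j = m j" if "\<phi> j = i" for j
    using that \<phi>_ne[of j] by auto
  \<comment> \<open>Rows whose block for user \<open>i\<close> vanishes contribute nothing, so the
    sum may run over all rows.\<close>
  have "(\<Sum>l\<in>{l. A $ l $ i \<noteq> 0}. q_avg E m i $ l * (A $ l $ i \<bullet> msg_y d))
      = (\<Sum>l\<in>UNIV. q_avg E m i $ l * (A $ l $ i \<bullet> msg_y d))"
    by (rule sum.mono_neutral_left) auto
  moreover have "(\<Sum>j\<in>nbrs E i. (msg_n (?m i) j $ l - f_con E A ?m i j $ l)\<^sup>2)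
      = (\<Sum>j\<in>nbrs E i. (msg_n d j $ l - f_con E A m i j $ l)\<^sup>2)" for l
    by (intro sum.cong) auto
  moreover have "(\<Sum>j\<in>nbrs E i. (msg_nu (?m i) j $ t - f_dem E ?m i j $ t)\<^sup>2)
      = (\<Sum>j\<in>nbrs E i. (msg_nu d j $ t - f_dem E m i j $ t)\<^sup>2)" for t
    by (intro sum.cong) auto
  moreover have "(\<Sum>j\<in>{j. \<phi> j = i}. (msg_beta (?m i) j $ t - msg_y (?m j) $ t)\<^sup>2)
      = (\<Sum>j\<in>{j. \<phi> j = i}. (msg_beta d j $ t - msg_y (m j) $ t)\<^sup>2)" for t
    by (intro sum.cong) (auto simp: \<phi>_ne[symmetric])
  moreover have "(\<Sum>j\<in>nbrs E i. f_con E A ?m i j $ l) = (\<Sum>j\<in>nbrs E i. f_con E A m i j $ l)" for l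
    by (intro sum.cong) auto
  ultimately show ?thesis
    by (simp add: payoff_def tax_def net_utility_def deviation_def price_penalty_def con_gap_def
        dem_gap_def inner_vec_def[of "p + _"] sum.distrib fun_upd_same del: fun_upd_apply)
qed

text \<open>Since the payoff is a sum of terms in separate message components, a best response is
  one that is best in each component. Necessity follows by changing one component at a time,
  sufficiency by adding the inequalities.\<close>

lemma mechanism_equilibrium_iff:
  fixes v :: "'n::finite \<Rightarrow> 't::finite \<Rightarrow> real \<Rightarrow> real"
    and A :: "real^'t^'n^'l::finite"
  assumes irrefl: "\<And>j. \<not> E j j" and \<phi>: "\<And>j. \<phi> j \<in> nbrs E j"
  shows "mechanism_equilibrium v p p0 A b E \<phi> m \<longleftrightarrow> (\<forall>i.
     m i \<in> messages E \<phi> i \<and>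
     (\<forall>y. net_utility v A (p + radial_pricing p0 (s_avg E m i) (zeta E \<phi> m i)) (q_avg E m i) i y
       \<le> net_utility v A (p + radial_pricing p0 (s_avg E m i) (zeta E \<phi> m i)) (q_avg E m i) i (msg_y (m i))) \<and>
     (\<forall>j\<in>nbrs E i. msg_n (m i) j = f_con E A m i j) \<and>
     (\<forall>j\<in>nbrs E i. msg_nu (m i) j = f_dem E m i j) \<and>
     (\<forall>j. \<phi> j = i \<longrightarrow> msg_beta (m i) j = msg_y (m j)) \<and>
     (\<forall>l. msg_q (m i) $ l = max 0 (q_avg E m i $ l - con_gap E A b \<phi> m i $ l / 2)) \<and>
     (\<forall>t. msg_s (m i) $ t = max 0 (s_avg E m i $ t - dem_gap E \<phi> m i $ t / 2)))"
    (is "_ \<longleftrightarrow> (\<forall>i. ?mem i \<and> ?Y i \<and> ?N i \<and> ?NU i \<and> ?B i \<and> ?Q i \<and> ?S i)")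
proof -
  note dev = payoff_deviate[of E \<phi> v p p0 A b, OF irrefl \<phi>]
  \<comment> \<open>Viewing the current message as a deviation to itself lets
    \<open>payoff_deviate\<close> expand both sides of the comparison.\<close>
  have own: "payoff v p p0 A b E \<phi> i m = payoff v p p0 A b E \<phi> i (m(i := m i))" for i
    by simp
  have "(\<forall>d\<in>messages E \<phi> i. payoff v p p0 A b E \<phi> i (m(i := d)) \<le> payoff v p p0 A b E \<phi> i m)
      \<longleftrightarrow> ?Y i \<and> ?N i \<and> ?NU i \<and> ?B i \<and> ?Q i \<and> ?S i" (is "?best \<longleftrightarrow> _") if mem: "?mem i" for i
  proof -
    let ?c = "con_gap E A b \<phi> m i" and ?z = "dem_gap E \<phi> m i"
    have q0: "0 \<le> msg_q (m i) $ l" and s0: "0 \<le> msg_s (m i) $ t" for l t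
      using mem by (auto simp: messages_def)
    note Q_iff = price_penalty_minimizer_iff[of "msg_q (m i)" ?c "q_avg E m i", OF q0]
    note S_iff = price_penalty_minimizer_iff[of "msg_s (m i)" ?z "s_avg E m i", OF s0]
    show ?thesis
    proof
      assume best: ?best
      note better = best[rule_format, unfolded own, unfolded dev]
      have "?Y i"
      proof
        fix y
        show "net_utility v A (p + radial_pricing p0 (s_avg E m i) (zeta E \<phi> m i)) (q_avg E m i) i y
          \<le> net_utility v A (p + radial_pricing p0 (s_avg E m i) (zeta E \<phi> m i)) (q_avg E m i) i (msg_y (m i))"
          using better[of "m i\<lparr>msg_y := y\<rparr>"] mem by (simp add: messages_def)
      qed
      moreover have "?N i"
      proof -
        \<comment> \<open>The restriction keeps the deviation inside \<open>messages\<close>, whose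
          indexed components are extensional.\<close>
        let ?n = "restrict (f_con E A m i) (nbrs E i)"
        have "deviation (nbrs E i) ?n (f_con E A m i) = 0"
          by (simp add: deviation_eq_0)
        then have "deviation (nbrs E i) (msg_n (m i)) (f_con E A m i) \<le> 0"
          using better[of "m i\<lparr>msg_n := ?n\<rparr>"] mem by (simp add: messages_def)
        then show ?thesis
          using deviation_nonneg[of "nbrs E i" "msg_n (m i)" "f_con E A m i"]
          by (simp add: deviation_eq_0[symmetric])
      qed
      moreover have "?NU i"
      proof -
        let ?n = "restrict (f_dem E m i) (nbrs E i)"
        have "deviation (nbrs E i) ?n (f_dem E m i) = 0"
          by (simp add: deviation_eq_0)
        then have "deviation (nbrs E i) (msg_nu (m i)) (f_dem E m i) \<le> 0"
          using better[of "m i\<lparr>msg_nu := ?n\<rparr>"] mem by (simp add: messages_def)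
        then show ?thesis
          using deviation_nonneg[of "nbrs E i" "msg_nu (m i)" "f_dem E m i"]
          by (simp add: deviation_eq_0[symmetric])
      qed
      moreover have "?B i"
      proof -
        let ?J = "{j. \<phi> j = i}"
        let ?n = "restrict (\<lambda>j. msg_y (m j)) ?J"
        have "deviation ?J ?n (\<lambda>j. msg_y (m j)) = 0"
          by (simp add: deviation_eq_0)
        then have "deviation ?J (msg_beta (m i)) (\<lambda>j. msg_y (m j)) \<le> 0"
          using better[of "m i\<lparr>msg_beta := ?n\<rparr>"] mem by (simp add: messages_def)
        then have "deviation ?J (msg_beta (m i)) (\<lambda>j. msg_y (m j)) = 0"
          using deviation_nonneg[of ?J "msg_beta (m i)" "\<lambda>j. msg_y (m j)"] by simp
        then show ?thesis by (simp add: deviation_eq_0)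
      qed
      moreover have "?Q i"
        unfolding Q_iff[symmetric]
      proof (intro allI impI)
        fix y :: "real^'l" assume "\<forall>l. 0 \<le> y $ l"
        then show "price_penalty ?c (q_avg E m i) (msg_q (m i)) \<le> price_penalty ?c (q_avg E m i) y"
          using better[of "m i\<lparr>msg_q := y\<rparr>"] mem by (simp add: messages_def)
      qed
      moreover have "?S i"
        unfolding S_iff[symmetric]
      proof (intro allI impI)
        fix y :: "real^'t" assume "\<forall>t. 0 \<le> y $ t"
        then show "price_penalty ?z (s_avg E m i) (msg_s (m i)) \<le> price_penalty ?z (s_avg E m i) y"
          using better[of "m i\<lparr>msg_s := y\<rparr>"] mem by (simp add: messages_def)
      qed
      ultimately show "?Y i \<and> ?N i \<and> ?NU i \<and> ?B i \<and> ?Q i \<and> ?S i" by blast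
    next
      assume R: "?Y i \<and> ?N i \<and> ?NU i \<and> ?B i \<and> ?Q i \<and> ?S i"
      show ?best
      proof
        fix d :: "('n, 't, 'l) message" assume d: "d \<in> messages E \<phi> i"
        have "price_penalty ?c (q_avg E m i) (msg_q (m i)) \<le> price_penalty ?c (q_avg E m i) (msg_q d)"
          using R Q_iff d by (simp add: messages_def)
        moreover have "price_penalty ?z (s_avg E m i) (msg_s (m i)) \<le> price_penalty ?z (s_avg E m i) (msg_s d)"
          using R S_iff d by (simp add: messages_def)
        moreover have "deviation (nbrs E i) (msg_n (m i)) (f_con E A m i) = 0"
            "deviation (nbrs E i) (msg_nu (m i)) (f_dem E m i) = 0"
            "deviation {j. \<phi> j = i} (msg_beta (m i)) (\<lambda>j. msg_y (m j)) = 0"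
          using R by (simp_all add: deviation_eq_0)
        moreover have "net_utility v A (p + radial_pricing p0 (s_avg E m i) (zeta E \<phi> m i)) (q_avg E m i) i (msg_y d)
          \<le> net_utility v A (p + radial_pricing p0 (s_avg E m i) (zeta E \<phi> m i)) (q_avg E m i) i (msg_y (m i))"
          using R by blast
        ultimately show "payoff v p p0 A b E \<phi> i (m(i := d)) \<le> payoff v p p0 A b E \<phi> i m"
          unfolding own[of i] dev
          using deviation_nonneg[of "nbrs E i" "msg_n d" "f_con E A m i"]
            deviation_nonneg[of "nbrs E i" "msg_nu d" "f_dem E m i"]
            deviation_nonneg[of "{j. \<phi> j = i}" "msg_beta d" "\<lambda>j. msg_y (m j)"]
          by linarith
      qed
    qed
  qed
  then show ?thesis
    unfolding mechanism_equilibrium_def nash_equilibrium_def by blast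
qed

section \<open>Totals computed by message passing\<close>

lemma f_con_total:
  fixes E :: "'n::finite \<Rightarrow> 'n \<Rightarrow> bool" and A :: "real^'t::finite^'n^'l::finite"
  assumes "tree_graph E"
    and n: "\<And>i. \<forall>j\<in>nbrs E i. msg_n (m i) j = f_con E A m i j"
  shows "A $ l $ i \<bullet> msg_y (m i) + (\<Sum>j\<in>nbrs E i. f_con E A m i j $ l)
    = (\<Sum>k\<in>UNIV. A $ l $ k \<bullet> msg_y (m k))"
\<comment> \<open>Once every \<open>msg_n\<close> copies its target, \<open>f_con\<close> satisfies
  the branch recursion on the tree.\<close>
proof (rule tree_branch_sums_total[OF assms(1)])
  fix i j
  have "(\<Sum>h\<in>nbrs E j - {i}. msg_n (m j) h $ l) = (\<Sum>h\<in>nbrs E j - {i}. f_con E A m j h $ l)"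
    by (intro sum.cong) (auto simp: n)
  then show "f_con E A m i j $ l = A $ l $ j \<bullet> msg_y (m j) + (\<Sum>h\<in>nbrs E j - {i}. f_con E A m j h $ l)"
    by (simp add: f_con_def[of E A m i j])
qed

lemma f_dem_total:
  fixes E :: "'n::finite \<Rightarrow> 'n \<Rightarrow> bool"
    and m :: "'n \<Rightarrow> ('n, 't::finite, 'l::finite) message"
  assumes "tree_graph E"
    and n: "\<And>i. \<forall>j\<in>nbrs E i. msg_nu (m i) j = f_dem E m i j"
  shows "msg_y (m i) $ t + (\<Sum>j\<in>nbrs E i. f_dem E m i j $ t) = (\<Sum>k\<in>UNIV. msg_y (m k) $ t)"
proof (rule tree_branch_sums_total[OF assms(1)])
  fix i j
  have "(\<Sum>h\<in>nbrs E j - {i}. msg_nu (m j) h $ t) = (\<Sum>h\<in>nbrs E j - {i}. f_dem E m j h $ t)"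
    by (intro sum.cong) (auto simp: n)
  then show "f_dem E m i j $ t = msg_y (m j) $ t + (\<Sum>h\<in>nbrs E j - {i}. f_dem E m j h $ t)"
    by (simp add: f_dem_def[of E m i j])
qed

section \<open>Radial prices\<close>

lemma is_arg_max_nth_iff:
  "is_arg_max (($) y) (\<lambda>_. True) t \<longleftrightarrow> y $ t = Max (range (($) y))" for y :: "real^'t::finite"
proof -
  have "is_arg_max (($) y) (\<lambda>_. True) t \<longleftrightarrow> Max (range (($) y)) \<le> y $ t"
    by (auto simp: is_arg_max_def not_less)
  moreover have "y $ t \<le> Max (range (($) y))" by simp
  ultimately show ?thesis by linarith
qed

text \<open>Either case of the definition distributes \<open>p0\<close> over slots of maximal load,
  which describes a subgradient of \<open>p0\<close> times the maximum.\<close>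

lemma radial_pricing_subgradient:
  fixes s y :: "real^'t::finite"
  assumes "0 \<le> p0" and s: "\<And>t. 0 \<le> s $ t"
    and supp: "\<And>t. s $ t \<noteq> 0 \<Longrightarrow> y $ t = Max (range (($) y))"
  shows "0 \<le> radial_pricing p0 s y $ t"
    and "(\<Sum>t\<in>UNIV. radial_pricing p0 s y $ t) = p0"
    and "radial_pricing p0 s y $ t \<noteq> 0 \<Longrightarrow> y $ t = Max (range (($) y))"
proof -
  define M where "M = {t. y $ t = Max (range (($) y))}"
  have rp: "radial_pricing p0 s y $ t = (if s \<noteq> 0 then s $ t / (\<Sum>t'\<in>UNIV. s $ t') * p0
      else p0 * indicator M t / real (card M))" for t
    by (simp add: radial_pricing_def M_def is_arg_max_nth_iff)
  \<comment> \<open>The set of maximal slots is nonempty, so \<open>p0 / real (card M)\<close> is a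
    genuine quotient.\<close>
  have "Max (range (($) y)) \<in> range (($) y)" by (intro Max_in) auto
  then obtain t0 where "y $ t0 = Max (range (($) y))" by (metis imageE)
  then have "t0 \<in> M" by (simp add: M_def)
  then have M: "card M \<noteq> 0" by auto
  show "0 \<le> radial_pricing p0 s y $ t"
    using assms by (simp add: rp sum_nonneg)
  show "radial_pricing p0 s y $ t \<noteq> 0 \<Longrightarrow> y $ t = Max (range (($) y))"
    using supp[of t] by (auto simp: rp M_def indicator_def split: if_splits)
  show "(\<Sum>t\<in>UNIV. radial_pricing p0 s y $ t) = p0"
  proof (cases "s = 0")
    case True
    then have "radial_pricing p0 s y $ t = (if t \<in> M then p0 / real (card M) else 0)" for t
      by (subst rp) simp
    with M show ?thesis by (simp add: sum.If_cases)
  next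
    case False
    then have "(\<Sum>t\<in>UNIV. s $ t) \<noteq> 0"
      using s by (auto simp: sum_nonneg_eq_0_iff vec_eq_iff)
    with False show ?thesis
      by (simp add: rp sum_divide_distrib[symmetric] sum_distrib_right[symmetric])
  qed
qed

text \<open>Multipliers of total \<open>p0\<close> can thus be announced as \<open>msg_s\<close> and
  are charged unchanged; if they all vanish, so does \<open>p0\<close>.\<close>

lemma radial_pricing_normalized:
  fixes \<pi> y :: "real^'t::finite"
  assumes "\<And>t. 0 \<le> \<pi> $ t"
  shows "radial_pricing (\<Sum>t\<in>UNIV. \<pi> $ t) \<pi> y = \<pi>"
proof (cases "\<pi> = 0")
  case False
  then have "(\<Sum>t\<in>UNIV. \<pi> $ t) \<noteq> 0"
    using assms by (auto simp: sum_nonneg_eq_0_iff vec_eq_iff)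
  with False show ?thesis by (simp add: radial_pricing_def vec_eq_iff)
qed (simp add: radial_pricing_def vec_eq_iff)

text \<open>The branches at user \<open>i\<close> cover everybody else, and the proxy
  \<open>msg_beta\<close> held by \<open>\<phi> i\<close> supplies the missing own demand. All users
  therefore see the same totals.\<close>

lemma equilibrium_gaps:
  fixes E :: "'n::finite \<Rightarrow> 'n \<Rightarrow> bool" and A :: "real^'t::finite^'n^'l::finite"
  assumes "tree_graph E"
    and "\<And>i. \<forall>j\<in>nbrs E i. msg_n (m i) j = f_con E A m i j"
    and "\<And>i. \<forall>j\<in>nbrs E i. msg_nu (m i) j = f_dem E m i j"
    and \<beta>: "\<And>j. msg_beta (m (\<phi> j)) j = msg_y (m j)"
  shows "con_gap E A b \<phi> m i $ l = b $ l - (\<Sum>k\<in>UNIV. A $ l $ k \<bullet> msg_y (m k))"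
    and "zeta E \<phi> m i = (\<chi> t. \<Sum>k\<in>UNIV. msg_y (m k) $ t)"
    and "dem_gap E \<phi> m i $ t = Max (range (\<lambda>t. \<Sum>k\<in>UNIV. msg_y (m k) $ t)) - (\<Sum>k\<in>UNIV. msg_y (m k) $ t)"
proof -
  show "con_gap E A b \<phi> m i $ l = b $ l - (\<Sum>k\<in>UNIV. A $ l $ k \<bullet> msg_y (m k))"
    using f_con_total[OF assms(1,2), of l i] by (simp add: con_gap_def \<beta>)
  show zeta: "zeta E \<phi> m i = (\<chi> t. \<Sum>k\<in>UNIV. msg_y (m k) $ t)"
    unfolding zeta_def vec_eq_iff using f_dem_total[OF assms(1,3), of i] by (simp add: \<beta> add.commute)
  show "dem_gap E \<phi> m i $ t = Max (range (\<lambda>t. \<Sum>k\<in>UNIV. msg_y (m k) $ t)) - (\<Sum>k\<in>UNIV. msg_y (m k) $ t)"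
    by (simp add: dem_gap_def zeta_max_def zeta)
qed

section \<open>Optimality and existence of equilibria\<close>

lemma equilibrium_optimal:
  fixes v :: "'n::finite \<Rightarrow> 't::finite \<Rightarrow> real \<Rightarrow> real"
    and A :: "real^'t^'n^'l::finite"
  assumes "0 \<le> p0" and tree: "tree_graph E" and \<phi>: "\<And>i. \<phi> i \<in> nbrs E i"
    and eq: "mechanism_equilibrium v p p0 A b E \<phi> m"
  shows "optimal_allocation v p p0 A b (allocation m)"
proof -
  have irrefl: "\<not> E j j" and conn: "E\<^sup>*\<^sup>* i j" for i j
    using tree by (auto simp: tree_graph_def dest: irreflpD)
  have ne: "nbrs E i \<noteq> {}" for i using \<phi>[of i] by blast
  note E = eq[unfolded mechanism_equilibrium_iff[of E \<phi>, OF irrefl \<phi>], rule_format]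
  define load where "load = (\<chi> t. \<Sum>k\<in>UNIV. msg_y (m k) $ t)"
  define gap where "gap l = b $ l - (\<Sum>k\<in>UNIV. A $ l $ k \<bullet> msg_y (m k))" for l
  have load_nth: "load $ t = (\<Sum>k\<in>UNIV. msg_y (m k) $ t)" for t by (simp add: load_def)
  note gaps = equilibrium_gaps[OF tree, of m A \<phi>]
  have con_gap: "con_gap E A b \<phi> m i $ l = gap l"
    and zeta: "zeta E \<phi> m i = load"
    and dem_gap: "dem_gap E \<phi> m i $ t = Max (range (($) load)) - load $ t" for i l t
    using E by (simp_all add: gaps gap_def load_nth) (simp add: load_def)
  have q: "msg_q (m i) $ l = max 0 (1 / real (card (nbrs E i)) * (\<Sum>j\<in>nbrs E i. msg_q (m j) $ l) - gap l / 2)"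
    for i l
    using E[of i] by (simp add: con_gap q_avg_def)
  have s: "msg_s (m i) $ t = max 0 (1 / real (card (nbrs E i)) * (\<Sum>j\<in>nbrs E i. msg_s (m j) $ t)
      - (Max (range (($) load)) - load $ t) / 2)" for i t
    using E[of i] by (simp add: dem_gap s_avg_def)
  \<comment> \<open>Consensus applies because the gaps no longer depend on the user.\<close>
  note q_cons = average_consensus[of E "\<lambda>i. msg_q (m i) $ l" "gap l" for l, OF conn ne q]
  note s_cons = average_consensus[of E "\<lambda>i. msg_s (m i) $ t" "Max (range (($) load)) - load $ t" for t, OF conn ne s]
  obtain i0 :: 'n where True by simp
  define Q where "Q = msg_q (m i0)"
  define S where "S = msg_s (m i0)"
  have "msg_q (m i) = Q" "msg_s (m i) = S" for i
    unfolding Q_def S_def vec_eq_iff using q_cons(2) s_cons(2) by blast+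
  then have avg: "q_avg E m i = Q" "s_avg E m i = S" for i
    by (simp_all add: q_avg_def s_avg_def vec_eq_iff ne)
  have S: "0 \<le> S $ t" "S $ t \<noteq> 0 \<Longrightarrow> load $ t = Max (range (($) load))" for t
    using s_cons(3)[of i0 t] E[of i0] by (auto simp: S_def messages_def)
  have Q: "0 \<le> Q $ l" "Q $ l \<noteq> 0 \<Longrightarrow> gap l = 0" for l
    using q_cons(3)[of i0 l] E[of i0] by (auto simp: Q_def messages_def)
  \<comment> \<open>The common \<open>S\<close> is supported on peak slots, so the radial price
    serves as the vector of slot multipliers.\<close>
  note rp = radial_pricing_subgradient[OF \<open>0 \<le> p0\<close> S]
  show ?thesis
  proof (rule optimal_allocation_if_net_utility_max[where q = Q and \<pi> = "radial_pricing p0 S load"])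
    show "allocation m \<in> feasible_set A b"
      using q_cons(1) by (simp add: feasible_set_def allocation_def gap_def)
    show "(\<Sum>i\<in>UNIV. A $ l $ i \<bullet> allocation m $ i) = b $ l" if "Q $ l \<noteq> 0" for l
      using Q(2)[OF that] by (simp add: gap_def allocation_def)
    show "(\<Sum>i\<in>UNIV. allocation m $ i $ t) = Max (range (\<lambda>t. \<Sum>i\<in>UNIV. allocation m $ i $ t))"
      if "radial_pricing p0 S load $ t \<noteq> 0" for t
      using rp(3)[OF _ that] by (simp add: allocation_def load_nth)
    show "net_utility v A (p + radial_pricing p0 S load) Q i y
        \<le> net_utility v A (p + radial_pricing p0 S load) Q i (allocation m $ i)" for i y
      using E[of i] by (simp add: allocation_def avg zeta)
  qed (auto simp: rp Q)
qed

lemma equilibrium_exists: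
  fixes v :: "'n::finite \<Rightarrow> 't::finite \<Rightarrow> real \<Rightarrow> real"
    and A :: "real^'t^'n^'l::finite"
  assumes "0 \<le> p0" and tree: "tree_graph E" and \<phi>: "\<And>i. \<phi> i \<in> nbrs E i"
    and v: "\<And>i t. strictly_concave (v i t)" "\<And>i t z. v i t differentiable at z"
    and opt: "optimal_allocation v p p0 A b x"
  shows "\<exists>m. mechanism_equilibrium v p p0 A b E \<phi> m"
proof -
  have irrefl: "\<not> E j j" for j
    using tree by (auto simp: tree_graph_def dest: irreflpD)
  have ne: "nbrs E i \<noteq> {}" for i using \<phi>[of i] by blast
  obtain q :: "real^'l" and \<pi> :: "real^'t" where q: "\<And>l. 0 \<le> q $ l"
    and \<pi>: "\<And>t. 0 \<le> \<pi> $ t" "(\<Sum>t\<in>UNIV. \<pi> $ t) = p0"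
    and cq: "\<And>l. q $ l \<noteq> 0 \<Longrightarrow> (\<Sum>i\<in>UNIV. A $ l $ i \<bullet> x $ i) = b $ l"
    and c\<pi>: "\<And>t. \<pi> $ t \<noteq> 0 \<Longrightarrow> (\<Sum>i\<in>UNIV. x $ i $ t) = Max (range (\<lambda>t. \<Sum>i\<in>UNIV. x $ i $ t))"
    and foc: "\<And>i t. deriv (v i t) (x $ i $ t) = p $ t + \<pi> $ t + (\<Sum>l\<in>UNIV. q $ l * A $ l $ i $ t)"
    by (rule optimal_allocation_multipliers[OF \<open>0 \<le> p0\<close> v(2) opt]) blast
  \<comment> \<open>The targets of \<open>msg_n\<close> refer to one another around the graph;
    branch sums on the tree solve this system, and \<open>G\<close> does the same for
    \<open>msg_nu\<close>.\<close>
  obtain F where F: "E i j \<Longrightarrow> F i j = (\<chi> l. A $ l $ j \<bullet> x $ j) + (\<Sum>h\<in>nbrs E j - {i}. F j h)" for i j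
    using tree_branch_sums_exist[OF tree, of "\<lambda>j. \<chi> l. A $ l $ j \<bullet> x $ j"] by blast
  obtain G where G: "E i j \<Longrightarrow> G i j = x $ j + (\<Sum>h\<in>nbrs E j - {i}. G j h)" for i j
    using tree_branch_sums_exist[OF tree, of "\<lambda>j. x $ j"] by blast
  define m :: "'n \<Rightarrow> ('n, 't, 'l) message" where
    "m i = \<lparr>msg_y = x $ i, msg_q = q, msg_s = \<pi>, msg_beta = restrict (($) x) {j. \<phi> j = i},
      msg_n = restrict (F i) (nbrs E i), msg_nu = restrict (G i) (nbrs E i)\<rparr>" for i
  have y: "msg_y (m i) = x $ i" for i by (simp add: m_def)
  have n: "\<forall>j\<in>nbrs E i. msg_n (m i) j = f_con E A m i j" for i
    using F[of i] by (simp add: m_def f_con_def vec_eq_iff nbrs_def)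
  have nu: "\<forall>j\<in>nbrs E i. msg_nu (m i) j = f_dem E m i j" for i
    using G[of i] by (simp add: m_def f_dem_def vec_eq_iff nbrs_def)
  have \<beta>: "msg_beta (m (\<phi> j)) j = msg_y (m j)" for j by (simp add: m_def)
  have avg: "q_avg E m i = q" "s_avg E m i = \<pi>" for i
    by (simp_all add: q_avg_def s_avg_def m_def vec_eq_iff ne)
  note gaps = equilibrium_gaps[of E m A \<phi>, OF tree n nu \<beta>, unfolded y]
  have feas: "(\<Sum>i\<in>UNIV. A $ l $ i \<bullet> x $ i) \<le> b $ l" for l
    using opt by (auto simp: optimal_allocation_def is_arg_max_def feasible_set_def)
  have "mechanism_equilibrium v p p0 A b E \<phi> m"
    unfolding mechanism_equilibrium_iff[of E \<phi>, OF irrefl \<phi>]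
  proof (intro allI conjI ballI impI)
    fix i
    show "m i \<in> messages E \<phi> i" by (simp add: messages_def m_def q \<pi>)
    \<comment> \<open>A positive multiplier has zero gap and stays at the average; a zero multiplier
      is held at 0 by a nonnegative gap. The same argument applies to \<open>msg_s\<close>.\<close>
    show "msg_q (m i) $ l = max 0 (q_avg E m i $ l - con_gap E A b \<phi> m i $ l / 2)" for l
      using cq[of l] q[of l] feas[of l] unfolding avg gaps by (cases "q $ l = 0") (simp_all add: m_def)
    show "msg_s (m i) $ t = max 0 (s_avg E m i $ t - dem_gap E \<phi> m i $ t / 2)" for t
    proof -
      have "(\<Sum>i\<in>UNIV. x $ i $ t) \<le> Max (range (\<lambda>t. \<Sum>i\<in>UNIV. x $ i $ t))" by simp
      then show ?thesis
        using c\<pi>[of t] \<pi>(1)[of t] unfolding avg gaps by (cases "\<pi> $ t = 0") (simp_all add: m_def)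
    qed
    show "net_utility v A (p + radial_pricing p0 (s_avg E m i) (zeta E \<phi> m i)) (q_avg E m i) i z
       \<le> net_utility v A (p + radial_pricing p0 (s_avg E m i) (zeta E \<phi> m i)) (q_avg E m i) i (msg_y (m i))" for z
      unfolding avg y radial_pricing_normalized[of \<pi>, OF \<pi>(1), unfolded \<pi>(2)]
      using v foc by (intro net_utility_max_if_first_order) auto
    show "msg_beta (m i) j = msg_y (m j)" if "\<phi> j = i" for j
      using that by (simp add: m_def)
  qed (use n nu in blast)+
  then show ?thesis by blast
qed

theorem theorem5:
  fixes v :: "'n::finite \<Rightarrow> 't::finite \<Rightarrow> real \<Rightarrow> real"
    and p :: "real^'t" and p0 :: real
    and A :: "real^'t^'n^'l::finite" and b :: "real^'l"
    and E :: "'n \<Rightarrow> 'n \<Rightarrow> bool" and \<phi> :: "'n \<Rightarrow> 'n"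
  assumes "CARD('n) \<ge> 2"
    and "p0 \<ge> 0"
    and "\<And>i t. twice_differentiable (v i t)"
    and "\<And>i t. strictly_concave (v i t)"
    and "\<And>l. b $ l \<ge> 0"
    and "polytope (feasible_set A b)"
    and "coordinate_convex (feasible_set A b)"
    and "tree_graph E"
    and "\<And>i. \<phi> i \<in> nbrs E i"
  shows "(\<exists>m. mechanism_equilibrium v p p0 A b E \<phi> m) \<and>
         (\<exists>!xopt. optimal_allocation v p p0 A b xopt) \<and>
         (\<forall>m xopt. mechanism_equilibrium v p p0 A b E \<phi> m \<longrightarrow>
                   optimal_allocation v p p0 A b xopt \<longrightarrow> allocation m = xopt)"
proof -
  have diff: "v i t differentiable at z" for i t z
    using assms(3) by (simp add: twice_differentiable_def)
  then have "continuous_on UNIV (v i t)" for i t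
    by (intro differentiable_imp_continuous_on) (simp add: differentiable_on_def)
  then obtain x where x: "optimal_allocation v p p0 A b x"
    using optimal_allocation_exists[of v A b] polytope_imp_compact assms(5,6) by blast
  have unique: "x' = x''"
    if "optimal_allocation v p p0 A b x'" "optimal_allocation v p p0 A b x''" for x' x''
    using optimal_allocation_unique[OF assms(4,2) that] .
  \<comment> \<open>The optimum supplies an equilibrium, and uniqueness identifies the allocation of
    any equilibrium with it.\<close>
  show ?thesis
    using equilibrium_exists[OF assms(2,8,9,4) diff x] x unique
      equilibrium_optimal[OF assms(2,8,9)] by blast
qed

end
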